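(* Let $V$ be an $n$-dimensional Euclidean vector space, $G\subset SO(V)$ a closed connected subgroup acting transitively on the unit sphere, and $r_1,r_2\ge0$ integers. Let $\Phi_1,\dots,\Phi_{m_1}$ be a basis of $\mathrm{Val}^{r_1,G}$ and $\Psi_1,\dots,\Psi_{m_2}$ a basis of $\mathrm{Val}^{r_2,G}$. If $\Phi\in\mathrm{Val}^{r_1+r_2,G}$, then there exist constants $c_{ij}$ depending only on $\Phi$ such that $$\int_G(\mathrm{id}^{\otimes r_1}\otimes g^{\otimes r_2})\,\Phi(K+g^{-1}L)\,dg=\sum_{i,j}c_{ij}\,\Phi_i(K)\otimes\Psi_j(L)$$ for all convex bodies $K,L\subset V$. In particular, the additive kinematic operator can be regarded as a linear map $a^{r_1,r_2}:\mathrm{Val}^{r_1+r_2,G}\to\mathrm{Val}^{r_1,G}\otimes\mathrm{Val}^{r_2,G}$.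
   Context: $dg$ is Haar probability measure on $G$. $\mathrm{Sym}^rV\subset V^{\otimes r}$ is the space of symmetric tensors; $G$ acts on it by $g^{\otimes r}$. $\mathrm{Val}^r$ is the space of translation-invariant, continuous maps $\Phi$ from convex bodies in $V$ to $\mathrm{Sym}^rV$ with $\Phi(K\cup L)=\Phi(K)+\Phi(L)-\Phi(K\cap L)$ whenever $K\cup L$ is convex; $\mathrm{Val}^{r,G}$ is the subspace of those with $g^{\otimes r}(\Phi(g^{-1}K))=\Phi(K)$ for all $g\in G$. Note $(\mathrm{id}^{\otimes r_1}\otimes g^{\otimes r_2})$ maps $\mathrm{Sym}^{r_1+r_2}V$ into $\mathrm{Sym}^{r_1}V\otimes\mathrm{Sym}^{r_2}V$. The additive kinematic operator is $a^{r_1,r_2}(\Phi)(K,L)=\int_G(\mathrm{id}^{\otimes r_1}\otimes g^{\otimes r_2})\Phi(K+g^{-1}L)\,dg$. *)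

theory Defs
  imports "HOL-Probability.Probability"
begin

text \<open>V is modelled as real^'n (Euclidean space of dimension CARD('n)).
Tensors of order r are functions on index lists of length r (zero elsewhere).\<close>

type_synonym 'n tensor = "'n list \<Rightarrow> real"

definition is_tensor :: "nat \<Rightarrow> ('n::finite) tensor \<Rightarrow> bool" where
  "is_tensor r T \<longleftrightarrow> (\<forall>is. length is \<noteq> r \<longrightarrow> T is = 0)"

definition Sym :: "nat \<Rightarrow> ('n::finite) tensor set" where
  "Sym r = {T. is_tensor r T \<and>
     (\<forall>is p. length is = r \<longrightarrow> p permutes {..<r} \<longrightarrow>
        T (map (\<lambda>k. is ! p k) [0..<r]) = T is)}"

definition tensor_pow_act :: "nat \<Rightarrow> real^'n^'n \<Rightarrow> ('n::finite) tensor \<Rightarrow> 'n tensor" where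
  "tensor_pow_act r g T = (\<lambda>is. if length is = r then
     (\<Sum>js\<in>{js. length js = r}. (\<Prod>k<r. g $ (is ! k) $ (js ! k)) * T js) else 0)"

definition id_tensor_act :: "nat \<Rightarrow> nat \<Rightarrow> real^'n^'n \<Rightarrow> ('n::finite) tensor \<Rightarrow> 'n tensor" where
  "id_tensor_act r1 r2 g T = (\<lambda>is. if length is = r1 + r2 then
     (\<Sum>js\<in>{js. length js = r2}.
        (\<Prod>k<r2. g $ (drop r1 is ! k) $ (js ! k)) * T (take r1 is @ js)) else 0)"

definition tensor_prod :: "nat \<Rightarrow> nat \<Rightarrow> ('n::finite) tensor \<Rightarrow> 'n tensor \<Rightarrow> 'n tensor" where
  "tensor_prod r1 r2 S T = (\<lambda>is. if length is = r1 + r2 then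
     S (take r1 is) * T (drop r1 is) else 0)"

definition convex_body :: "(real^'n::finite) set \<Rightarrow> bool" where
  "convex_body K \<longleftrightarrow> compact K \<and> convex K \<and> K \<noteq> {}"

definition minkowski_sum :: "(real^'n::finite) set \<Rightarrow> (real^'n) set \<Rightarrow> (real^'n) set" where
  "minkowski_sum K L = {x + y | x y. x \<in> K \<and> y \<in> L}"

definition hausdorff_dist :: "(real^'n::finite) set \<Rightarrow> (real^'n) set \<Rightarrow> real" where
  "hausdorff_dist K L = max (SUP x\<in>K. setdist {x} L) (SUP y\<in>L. setdist {y} K)"

definition Val :: "nat \<Rightarrow> ((real^'n::finite) set \<Rightarrow> 'n tensor) set" where
  "Val r = {\<Phi>.
     (\<forall>K. convex_body K \<longrightarrow> \<Phi> K \<in> Sym r) \<and>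
     (\<forall>K x. convex_body K \<longrightarrow> \<Phi> ((\<lambda>y. x + y) ` K) = \<Phi> K) \<and>
     (\<forall>K Ks. convex_body K \<longrightarrow> (\<forall>k. convex_body (Ks k)) \<longrightarrow>
        (\<lambda>k. hausdorff_dist (Ks k) K) \<longlonglongrightarrow> 0 \<longrightarrow>
        (\<forall>is. (\<lambda>k. \<Phi> (Ks k) is) \<longlonglongrightarrow> \<Phi> K is)) \<and>
     (\<forall>K L. convex_body K \<longrightarrow> convex_body L \<longrightarrow> convex (K \<union> L) \<longrightarrow>
        \<Phi> (K \<union> L) = (\<lambda>is. \<Phi> K is + \<Phi> L is - \<Phi> (K \<inter> L) is))}"

definition ValG :: "nat \<Rightarrow> (real^'n^'n) set \<Rightarrow> ((real^'n::finite) set \<Rightarrow> 'n tensor) set" where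
  "ValG r G = {\<Phi> \<in> Val r. \<forall>g\<in>G. \<forall>K. convex_body K \<longrightarrow>
      tensor_pow_act r g (\<Phi> ((\<lambda>x. matrix_inv g *v x) ` K)) = \<Phi> K}"

definition is_basis_ValG :: "nat \<Rightarrow> (real^'n^'n) set \<Rightarrow> nat \<Rightarrow>
    (nat \<Rightarrow> (real^'n::finite) set \<Rightarrow> 'n tensor) \<Rightarrow> bool" where
  "is_basis_ValG r G m B \<longleftrightarrow>
     (\<forall>i<m. B i \<in> ValG r G) \<and>
     (\<forall>c :: nat \<Rightarrow> real. (\<forall>K is. convex_body K \<longrightarrow> (\<Sum>i<m. c i * B i K is) = 0)
         \<longrightarrow> (\<forall>i<m. c i = 0)) \<and>
     (\<forall>\<Phi>\<in>ValG r G. \<exists>c :: nat \<Rightarrow> real. \<forall>K is. convex_body K \<longrightarrow>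
         \<Phi> K is = (\<Sum>i<m. c i * B i K is))"

definition SO_mat :: "(real^'n^'n::finite) set" where
  "SO_mat = {g. orthogonal_matrix g \<and> det g = 1}"

definition closed_connected_subgroup_SO :: "(real^'n^'n::finite) set \<Rightarrow> bool" where
  "closed_connected_subgroup_SO G \<longleftrightarrow> G \<subseteq> SO_mat \<and> mat 1 \<in> G \<and>
     (\<forall>g\<in>G. \<forall>h\<in>G. g ** h \<in> G) \<and> (\<forall>g\<in>G. matrix_inv g \<in> G) \<and>
     closed G \<and> connected G"

definition transitive_on_sphere :: "(real^'n^'n::finite) set \<Rightarrow> bool" where
  "transitive_on_sphere G \<longleftrightarrow>
     (\<forall>u v. norm u = 1 \<longrightarrow> norm v = 1 \<longrightarrow> (\<exists>g\<in>G. g *v u = (v :: real^'n)))"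

text \<open>Haar probability measure on G: a left-invariant Borel probability measure on the
matrices concentrated on G (unique for compact G).\<close>
definition haar_prob :: "(real^'n^'n::finite) set \<Rightarrow> (real^'n^'n) measure \<Rightarrow> bool" where
  "haar_prob G \<mu> \<longleftrightarrow> prob_space \<mu> \<and> sets \<mu> = sets borel \<and> emeasure \<mu> G = 1 \<and>
     (\<forall>h\<in>G. \<forall>A\<in>sets borel. A \<subseteq> G \<longrightarrow> emeasure \<mu> ((\<lambda>g. h ** g) ` A) = emeasure \<mu> A)"

definition additive_kinematic :: "nat \<Rightarrow> nat \<Rightarrow> (real^'n^'n) measure \<Rightarrow>
    ((real^'n::finite) set \<Rightarrow> 'n tensor) \<Rightarrow> (real^'n) set \<Rightarrow> (real^'n) set \<Rightarrow> 'n tensor" where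
  "additive_kinematic r1 r2 \<mu> \<Phi> K L = (\<lambda>is. LINT g|\<mu>.
     id_tensor_act r1 r2 g (\<Phi> (minkowski_sum K ((\<lambda>x. matrix_inv g *v x) ` L))) is)"

end

theory Submission
  imports Defs
begin

text \<open>In each of the two bodies the kinematic integral, read off with the tensor indices of the
  other factor fixed, is again a continuous, translation-invariant, \<open>G\<close>-equivariant tensor
  valuation: equivariance in \<open>L\<close> comes from left invariance of Haar measure, equivariance in \<open>K\<close>
  from right invariance together with the equivariance of \<open>\<Phi>\<close>. Expanding in \<open>L\<close> with respect to
  the second basis gives coefficients depending on \<open>K\<close>; since the basis functions are linearly
  independent, these coefficients are linear combinations of values of the integral at fixed \<open>L\<close>,
  hence lie in \<open>ValG r1 G\<close> and can be expanded with respect to the first basis.\<close>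

subsection \<open>The Hausdorff distance\<close>

text \<open>Two mismatches shape the details. First, \<mu> is a measure on all matrices, while
  \<open>matrix_inv\<close> is well behaved only on invertible ones. On the group the inverse is the
  transpose, which is continuous on the whole matrix space, so the limits and invariance arguments
  use an integrand written with \<open>transpose\<close>. Borel measurability of
  \<open>matrix_inv\<close> allows the given integral to be replaced by this one, since the
  integrands agree almost everywhere. Second, \<open>ValG\<close> constrains a function only on
  convex bodies, and expansions in a basis hold only there. The coefficient functions are therefore
  set to zero off bodies and off index lists of the right length, which affects neither linear
  relations nor membership in \<open>ValG\<close>.\<close>

lemma convex_body_minkowski_sum:
  assumes "convex_body K" "convex_body L"
  shows "convex_body (minkowski_sum K L)"
proof -
  have "minkowski_sum K L = (\<Union>x\<in>K. \<Union>y\<in>L. {x + y})"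
    by (auto simp: minkowski_sum_def)
  moreover have "minkowski_sum K L \<noteq> {}"
    using assms by (auto simp: minkowski_sum_def convex_body_def)
  ultimately show ?thesis
    using assms by (metis convex_body_def compact_sums' convex_sums)
qed

lemma convex_body_matrix_image:
  fixes A :: "real^'n::finite^'n"
  assumes "convex_body L"
  shows "convex_body ((*v) A ` L)"
  using assms
  by (auto simp: convex_body_def intro!: compact_continuous_image linear_continuous_on
      matrix_vector_mul_bounded_linear convex_linear_image)

lemma convex_body_translation:
  assumes "convex_body L"
  shows "convex_body ((+) x ` L)"
  using assms by (auto simp: convex_body_def convex_translation compact_translation)

text \<open>Estimates are made through nearest points: this criterion and its converse
  \<open>hausdorff_dist_witness\<close> keep the suprema of \<open>setdist\<close> out of the bounds
  for sums and matrix images.\<close>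

lemma hausdorff_dist_le:
  assumes "convex_body K" "convex_body L"
    and "\<And>x. x \<in> K \<Longrightarrow> \<exists>y\<in>L. dist x y \<le> e" "\<And>y. y \<in> L \<Longrightarrow> \<exists>x\<in>K. dist x y \<le> e"
  shows "hausdorff_dist K L \<le> e"
  unfolding hausdorff_dist_def
proof (rule max.boundedI)
  show "(SUP x\<in>K. setdist {x} L) \<le> e"
  proof (rule cSUP_least)
    fix x assume "x \<in> K"
    then obtain y where "y \<in> L" "dist x y \<le> e" using assms(3) by blast
    then show "setdist {x} L \<le> e" using setdist_le_dist[of x "{x}" y L] by auto
  qed (use assms in \<open>auto simp: convex_body_def\<close>)
  show "(SUP y\<in>L. setdist {y} K) \<le> e"
  proof (rule cSUP_least)
    fix y assume "y \<in> L"
    then obtain x where "x \<in> K" "dist x y \<le> e" using assms(4) by blast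
    then show "setdist {y} K \<le> e" using setdist_le_dist[of y "{y}" x K] by (auto simp: dist_commute)
  qed (use assms in \<open>auto simp: convex_body_def\<close>)
qed

text \<open>A real \<open>SUP\<close> is sure to dominate its members only on sets bounded above;
  here boundedness comes from compactness and continuity of \<open>setdist\<close>.\<close>

lemma setdist_le_SUP:
  assumes "compact K" "x \<in> K"
  shows "setdist {x} L \<le> (SUP x\<in>K. setdist {x} L)"
proof (rule cSUP_upper[OF assms(2)])
  have "compact ((\<lambda>x. setdist {x} L) ` K)"
    by (intro compact_continuous_image continuous_on_setdist assms)
  then show "bdd_above ((\<lambda>x. setdist {x} L) ` K)"
    by (intro bounded_imp_bdd_above compact_imp_bounded)
qed

lemma hausdorff_dist_commute: "hausdorff_dist K L = hausdorff_dist L K"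
  by (simp add: hausdorff_dist_def max.commute)

lemma hausdorff_dist_witness:
  assumes "convex_body K" "convex_body L" "x \<in> K"
  obtains y where "y \<in> L" "dist x y \<le> hausdorff_dist K L"
proof -
  obtain y where "y \<in> L" "dist x y = setdist {x} L"
    using setdist_compact_closed[of "{x}" L] assms
    by (auto simp: convex_body_def compact_imp_closed)
  moreover have "setdist {x} L \<le> hausdorff_dist K L"
    using setdist_le_SUP[of K x L] assms by (auto simp: hausdorff_dist_def convex_body_def)
  ultimately show ?thesis using that by auto
qed

lemma hausdorff_dist_nonneg:
  assumes "convex_body K" "convex_body L"
  shows "0 \<le> hausdorff_dist K L"
proof -
  obtain x where "x \<in> K" using assms by (auto simp: convex_body_def)
  then obtain y where "dist x y \<le> hausdorff_dist K L" using hausdorff_dist_witness assms by metis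
  then show ?thesis using zero_le_dist order_trans by blast
qed

lemma hausdorff_dist_self:
  assumes "convex_body K"
  shows "hausdorff_dist K K = 0"
  by (intro antisym hausdorff_dist_nonneg hausdorff_dist_le assms) auto

lemma hausdorff_dist_minkowski_sum:
  assumes K: "convex_body K" "convex_body K'" and L: "convex_body L" "convex_body L'"
  shows "hausdorff_dist (minkowski_sum K L) (minkowski_sum K' L')
    \<le> hausdorff_dist K K' + hausdorff_dist L L'"
proof (rule hausdorff_dist_le)
  fix z assume "z \<in> minkowski_sum K L"
  then obtain x y where xy: "z = x + y" "x \<in> K" "y \<in> L" by (auto simp: minkowski_sum_def)
  obtain x' y' where "x' \<in> K'" "dist x x' \<le> hausdorff_dist K K'"
    "y' \<in> L'" "dist y y' \<le> hausdorff_dist L L'"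
    using hausdorff_dist_witness K L xy by metis
  then show "\<exists>z'\<in>minkowski_sum K' L'. dist z z' \<le> hausdorff_dist K K' + hausdorff_dist L L'"
    using dist_triangle_add[of x y x' y'] xy
    by (intro bexI[of _ "x' + y'"]) (auto simp: minkowski_sum_def)
next
  fix z assume "z \<in> minkowski_sum K' L'"
  then obtain x y where xy: "z = x + y" "x \<in> K'" "y \<in> L'" by (auto simp: minkowski_sum_def)
  obtain x' y' where "x' \<in> K" "dist x x' \<le> hausdorff_dist K' K"
    "y' \<in> L" "dist y y' \<le> hausdorff_dist L' L"
    using hausdorff_dist_witness K L xy by metis
  then show "\<exists>z'\<in>minkowski_sum K L. dist z' z \<le> hausdorff_dist K K' + hausdorff_dist L L'"
    using dist_triangle_add[of x' y' x y] xy
    by (intro bexI[of _ "x' + y'"])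
      (auto simp: minkowski_sum_def hausdorff_dist_commute[of K'] hausdorff_dist_commute[of L']
        dist_commute)
qed (use assms convex_body_minkowski_sum in auto)

text \<open>Stands in for the operator norm: it dominates it, and its continuity in the matrix is
  immediate from the entries.\<close>

definition entry_norm :: "real^'n::finite^'n \<Rightarrow> real" where
  "entry_norm A = (\<Sum>i\<in>UNIV. \<Sum>j\<in>UNIV. \<bar>A $ i $ j\<bar>)"

lemma entry_norm_nonneg: "0 \<le> entry_norm A"
  by (simp add: entry_norm_def sum_nonneg)

lemma norm_matrix_vector_le: "norm (A *v x) \<le> entry_norm A * norm x"
proof -
  have "norm (A *v x) \<le> onorm ((*v) A) * norm x"
    by (simp add: onorm matrix_vector_mul_bounded_linear)
  also have "\<dots> \<le> entry_norm A * norm x"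
    unfolding entry_norm_def by (intro mult_right_mono onorm_le_matrix_component_sum) auto
  finally show ?thesis .
qed

text \<open>From A x - B y = A (x - y) + (A - B) y. This split asks for a norm bound on y alone, so
  in the limit argument R comes from the limit body.\<close>

lemma dist_matrix_vector_le:
  assumes "norm y \<le> R"
  shows "dist (A *v x) (B *v y) \<le> entry_norm A * dist x y + entry_norm (A - B) * R"
proof -
  have "A *v x - B *v y = A *v (x - y) + (A - B) *v y"
    by (simp add: matrix_vector_mult_diff_distrib matrix_vector_mult_diff_rdistrib)
  then have "dist (A *v x) (B *v y) \<le> norm (A *v (x - y)) + norm ((A - B) *v y)"
    by (metis dist_norm norm_triangle_ineq)
  also have "\<dots> \<le> entry_norm A * dist x y + entry_norm (A - B) * norm y"
    using norm_matrix_vector_le by (metis add_mono dist_norm)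
  finally show ?thesis
    using assms mult_left_mono[OF assms, of "entry_norm (A - B)"] entry_norm_nonneg[of "A - B"] by simp
qed

lemma hausdorff_dist_matrix_image:
  assumes "convex_body L" "convex_body L'" "\<And>y. y \<in> L' \<Longrightarrow> norm y \<le> R"
  shows "hausdorff_dist ((*v) A ` L) ((*v) B ` L')
    \<le> entry_norm A * hausdorff_dist L L' + entry_norm (A - B) * R"
proof (rule hausdorff_dist_le)
  fix z assume "z \<in> (*v) A ` L"
  then obtain x where x: "z = A *v x" "x \<in> L" by auto
  obtain y where y: "y \<in> L'" "dist x y \<le> hausdorff_dist L L'"
    using hausdorff_dist_witness assms x by metis
  then have "dist z (B *v y) \<le> entry_norm A * hausdorff_dist L L' + entry_norm (A - B) * R"
    using dist_matrix_vector_le[of y R A x B] x assms(3)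
      mult_left_mono[OF y(2) entry_norm_nonneg[of A]] by fastforce
  then show "\<exists>z'\<in>(*v) B ` L'. dist z z' \<le> entry_norm A * hausdorff_dist L L' + entry_norm (A - B) * R"
    using y by auto
next
  fix z assume "z \<in> (*v) B ` L'"
  then obtain y where y: "z = B *v y" "y \<in> L'" by auto
  obtain x where x: "x \<in> L" "dist y x \<le> hausdorff_dist L' L"
    using hausdorff_dist_witness assms y by metis
  then have *: "dist x y \<le> hausdorff_dist L L'"
    by (simp add: dist_commute hausdorff_dist_commute)
  have "dist (A *v x) z \<le> entry_norm A * hausdorff_dist L L' + entry_norm (A - B) * R"
    using dist_matrix_vector_le[of y R A x B] y assms(3)
      mult_left_mono[OF * entry_norm_nonneg[of A]] by fastforce
  then show "\<exists>z'\<in>(*v) A ` L. dist z' z \<le> entry_norm A * hausdorff_dist L L' + entry_norm (A - B) * R"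
    using x by auto
qed (use assms convex_body_matrix_image in auto)

lemma tendsto_entry_norm:
  assumes "(f \<longlongrightarrow> A) F"
  shows "((\<lambda>k. entry_norm (f k)) \<longlongrightarrow> entry_norm A) F"
  unfolding entry_norm_def using assms by (intro tendsto_intros)

text \<open>Bundles the hypotheses of the continuity clause of \<open>Val\<close>, so that limits of
  bodies compose like ordinary limits.\<close>

definition hausdorff_lim :: "(nat \<Rightarrow> (real^'n::finite) set) \<Rightarrow> (real^'n) set \<Rightarrow> bool" where
  "hausdorff_lim Ks K \<longleftrightarrow> convex_body K \<and> (\<forall>k. convex_body (Ks k)) \<and>
    (\<lambda>k. hausdorff_dist (Ks k) K) \<longlonglongrightarrow> 0"

lemma hausdorff_lim_const: "convex_body K \<Longrightarrow> hausdorff_lim (\<lambda>_. K) K"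
  by (simp add: hausdorff_lim_def hausdorff_dist_self)

lemma hausdorff_lim_subseq:
  "hausdorff_lim Ks K \<Longrightarrow> strict_mono s \<Longrightarrow> hausdorff_lim (\<lambda>k. Ks (s k)) K"
  using LIMSEQ_subseq_LIMSEQ[of "\<lambda>k. hausdorff_dist (Ks k) K" 0 s]
  by (auto simp: hausdorff_lim_def o_def)

lemma hausdorff_lim_minkowski_sum:
  assumes "hausdorff_lim Ks K" "hausdorff_lim Ls L"
  shows "hausdorff_lim (\<lambda>k. minkowski_sum (Ks k) (Ls k)) (minkowski_sum K L)"
proof -
  have "(\<lambda>k. hausdorff_dist (Ks k) K + hausdorff_dist (Ls k) L) \<longlonglongrightarrow> 0"
    using assms tendsto_add[of _ 0 sequentially _ 0] by (auto simp: hausdorff_lim_def)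
  then have "(\<lambda>k. hausdorff_dist (minkowski_sum (Ks k) (Ls k)) (minkowski_sum K L)) \<longlonglongrightarrow> 0"
    by (rule tendsto_0_le[where K = 1])
      (use assms in \<open>auto simp: hausdorff_lim_def hausdorff_dist_nonneg convex_body_minkowski_sum
        intro!: always_eventually order_trans[OF hausdorff_dist_minkowski_sum]\<close>)
  with assms show ?thesis by (simp add: hausdorff_lim_def convex_body_minkowski_sum)
qed

lemma hausdorff_lim_matrix_image:
  fixes A :: "real^'n::finite^'n"
  assumes "hausdorff_lim Ls L" "f \<longlonglongrightarrow> A"
  shows "hausdorff_lim (\<lambda>k. (*v) (f k) ` Ls k) ((*v) A ` L)"
proof -
  obtain R where R: "\<And>y. y \<in> L \<Longrightarrow> norm y \<le> R"
    using assms(1) compact_imp_bounded[of L]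
    by (auto simp: hausdorff_lim_def convex_body_def bounded_iff)
  have "(\<lambda>k. entry_norm (f k - A)) \<longlonglongrightarrow> entry_norm (A - A)"
    by (intro tendsto_entry_norm tendsto_diff assms(2) tendsto_const)
  then have "(\<lambda>k. entry_norm (f k) * hausdorff_dist (Ls k) L + entry_norm (f k - A) * R)
      \<longlonglongrightarrow> entry_norm A * 0 + entry_norm (A - A) * R"
    using assms by (intro tendsto_intros tendsto_entry_norm) (auto simp: hausdorff_lim_def)
  then have *: "(\<lambda>k. entry_norm (f k) * hausdorff_dist (Ls k) L + entry_norm (f k - A) * R)
      \<longlonglongrightarrow> 0"
    by (simp add: entry_norm_def)
  have bound: "hausdorff_dist ((*v) (f k) ` Ls k) ((*v) A ` L)
      \<le> entry_norm (f k) * hausdorff_dist (Ls k) L + entry_norm (f k - A) * R" for k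
    using assms(1) R by (intro hausdorff_dist_matrix_image) (auto simp: hausdorff_lim_def)
  have nonneg: "0 \<le> hausdorff_dist ((*v) (f k) ` Ls k) ((*v) A ` L)" for k
    using assms(1) by (intro hausdorff_dist_nonneg convex_body_matrix_image) (auto simp: hausdorff_lim_def)
  have "(\<lambda>k. hausdorff_dist ((*v) (f k) ` Ls k) ((*v) A ` L)) \<longlonglongrightarrow> 0"
    by (rule tendsto_sandwich[OF _ _ tendsto_const *]) (use bound nonneg in auto)
  with assms(1) show ?thesis by (simp add: hausdorff_lim_def convex_body_matrix_image)
qed

subsection \<open>Minkowski sums\<close>

text \<open>Addition is a linear map on the product space, which brings sums within reach of
  \<open>linear_image_Int\<close>.\<close>

lemma minkowski_sum_eq_image: "minkowski_sum K L = (\<lambda>z. fst z + snd z) ` (K \<times> L)"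
  unfolding minkowski_sum_def by (auto simp: image_def)

lemma minkowski_sum_translation_left:
  "minkowski_sum ((+) x ` K) L = (+) x ` minkowski_sum K L"
proof -
  have "((+) x ` K) \<times> L = (\<lambda>z. (x + fst z, snd z)) ` (K \<times> L)"
    by (auto simp: image_def)
  then show ?thesis
    unfolding minkowski_sum_eq_image by (simp only: image_image fst_conv snd_conv add.assoc)
qed

lemma minkowski_sum_commute: "minkowski_sum K L = minkowski_sum L K"
  by (auto simp: minkowski_sum_def) (metis add.commute)+

lemma matrix_image_minkowski_sum:
  "(*v) A ` minkowski_sum K L = minkowski_sum ((*v) A ` K) ((*v) A ` L)"
proof -
  have "((*v) A ` K) \<times> ((*v) A ` L) = (\<lambda>z. (A *v fst z, A *v snd z)) ` (K \<times> L)"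
    by (auto simp: image_def)
  then show ?thesis
    unfolding minkowski_sum_eq_image
    by (simp only: image_image fst_conv snd_conv matrix_vector_right_distrib)
qed

lemma minkowski_sum_Un_left:
  "minkowski_sum (K \<union> K') L = minkowski_sum K L \<union> minkowski_sum K' L"
  by (auto simp: minkowski_sum_def)

text \<open>The empty set is no convex body, so nonemptiness is the point: a convex union is
  connected and cannot split into two disjoint nonempty closed sets.\<close>

lemma convex_body_Int:
  assumes "convex_body K" "convex_body K'" "convex (K \<union> K')"
  shows "convex_body (K \<inter> K')"
proof -
  have "K \<inter> K' \<noteq> {}"
  proof
    assume "K \<inter> K' = {}"
    moreover have "closed K" "closed K'" "K \<noteq> {}" "K' \<noteq> {}"
      using assms(1,2) by (auto simp: convex_body_def compact_imp_closed)
    ultimately show False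
      using convex_connected[OF assms(3)] unfolding connected_closed by blast
  qed
  then show ?thesis
    using assms by (auto simp: convex_body_def compact_Int convex_Int)
qed

text \<open>Two preimages of the same point, one in each set, span a segment that is mapped to that
  point and that meets the intersection.\<close>
lemma linear_image_Int:
  fixes f :: "'a::real_normed_vector \<Rightarrow> 'b::real_vector"
  assumes f: "linear f" and S: "closed S" and T: "closed T" and conv: "convex (S \<union> T)"
  shows "f ` (S \<inter> T) = f ` S \<inter> f ` T"
proof
  show "f ` S \<inter> f ` T \<subseteq> f ` (S \<inter> T)"
  proof
    fix z assume "z \<in> f ` S \<inter> f ` T"
    then obtain x y where xy: "x \<in> S" "y \<in> T" "f x = z" "f y = z" by auto
    have sub: "closed_segment x y \<subseteq> S \<union> T"
      using conv xy by (intro closed_segment_subset) auto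
    have "S \<inter> T \<inter> closed_segment x y \<noteq> {}"
      using connected_segment(1)[of x y] sub S T xy ends_in_segment[of x y]
      unfolding connected_closed by blast
    then obtain u where u: "(1 - u) *\<^sub>R x + u *\<^sub>R y \<in> S \<inter> T"
      by (auto simp: closed_segment_def)
    have "f ((1 - u) *\<^sub>R x + u *\<^sub>R y) = z"
      using xy by (simp add: linear_add[OF f] linear_scale[OF f] flip: scaleR_left_distrib)
    with u show "z \<in> f ` (S \<inter> T)" by blast
  qed
qed auto

text \<open>Sums and intersections do not commute in general. Here the products of K and K' with L
  have a convex union, so \<open>linear_image_Int\<close> applies to the addition map.\<close>

lemma minkowski_sum_Int_left:
  fixes K K' L :: "(real^'n::finite) set"
  assumes "convex_body K" "convex_body K'" "convex (K \<union> K')" and "convex_body L"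
  shows "minkowski_sum (K \<inter> K') L = minkowski_sum K L \<inter> minkowski_sum K' L"
proof -
  have "(\<lambda>z. fst z + snd z) ` (K \<times> L \<inter> K' \<times> L)
      = (\<lambda>z. fst z + snd z) ` (K \<times> L) \<inter> (\<lambda>z. fst z + snd z) ` (K' \<times> L)"
  proof (rule linear_image_Int)
    show "linear (\<lambda>z :: (real^'n) \<times> (real^'n). fst z + snd z)"
      by (intro linearI) (auto simp: algebra_simps)
    have "convex ((K \<union> K') \<times> L)" using assms by (intro convex_Times) (auto simp: convex_body_def)
    then show "convex (K \<times> L \<union> K' \<times> L)" by (simp add: Sigma_Un_distrib1)
  qed (use assms in \<open>auto simp: convex_body_def intro!: compact_Times compact_imp_closed\<close>)
  moreover have "K \<times> L \<inter> K' \<times> L = (K \<inter> K') \<times> L" by auto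
  ultimately show ?thesis by (simp add: minkowski_sum_eq_image)
qed

lemma convex_minkowski_sum:
  assumes "convex K" "convex L"
  shows "convex (minkowski_sum K L)"
proof -
  have "minkowski_sum K L = (\<Union>x\<in>K. \<Union>y\<in>L. {x + y})"
    by (auto simp: minkowski_sum_def)
  then show ?thesis using convex_sums[OF assms] by simp
qed

subsection \<open>Tensors\<close>

lemma length_eq_add_iff: "length xs = r1 + r2 \<longleftrightarrow> (\<exists>as bs. length as = r1 \<and> length bs = r2 \<and> xs = as @ bs)"
proof
  assume "length xs = r1 + r2"
  then show "\<exists>as bs. length as = r1 \<and> length bs = r2 \<and> xs = as @ bs"
    by (intro exI[of _ "take r1 xs"] exI[of _ "drop r1 xs"]) auto
qed auto

lemma sum_lists_append:
  fixes f :: "'n::finite list \<Rightarrow> 'a::comm_monoid_add"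
  shows "(\<Sum>js\<in>{js. length js = r1 + r2}. f js)
    = (\<Sum>as\<in>{as. length as = r1}. \<Sum>bs\<in>{bs. length bs = r2}. f (as @ bs))"
proof -
  have "bij_betw (\<lambda>(as, bs). as @ bs) ({as :: 'n list. length as = r1} \<times> {bs. length bs = r2})
      {js. length js = r1 + r2}"
    by (rule bij_betwI[where g = "\<lambda>js. (take r1 js, drop r1 js)"]) auto
  from sum.reindex_bij_betw[OF this, of f] show ?thesis
    by (simp add: sum.cartesian_product case_prod_unfold)
qed

text \<open>Distributivity in the form that merges one sum per slot into one sum over intermediate
  index lists; this makes the tensor power multiplicative in the matrix.\<close>

lemma prod_sum_lists:
  fixes f :: "nat \<Rightarrow> 'n::finite \<Rightarrow> 'a::comm_semiring_1"
  shows "(\<Prod>k<r. \<Sum>x\<in>UNIV. f k x) = (\<Sum>js\<in>{js. length js = r}. \<Prod>k<r. f k (js ! k))"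
proof (induction r)
  case 0
  have "{js :: 'n list. length js = 0} = {[]}" by auto
  then show ?case by simp
next
  case (Suc r)
  have bij: "bij_betw (\<lambda>x. [x]) (UNIV :: 'n set) {bs. length bs = 1}"
    by (rule bij_betwI[where g = hd]) (auto simp: length_Suc_conv)
  have "(\<Sum>js\<in>{js. length js = Suc r}. \<Prod>k<Suc r. f k (js ! k))
    = (\<Sum>as\<in>{as. length as = r}. \<Sum>bs\<in>{bs. length bs = 1}. \<Prod>k<Suc r. f k ((as @ bs) ! k))"
    using sum_lists_append[of "\<lambda>js. \<Prod>k<Suc r. f k (js ! k)" r 1] by simp
  also have "\<dots> = (\<Sum>as\<in>{as. length as = r}. \<Sum>x\<in>UNIV. \<Prod>k<Suc r. f k ((as @ [x]) ! k))"
    by (simp only: sum.reindex_bij_betw[OF bij, of "\<lambda>bs. \<Prod>k<Suc r. f k ((_ @ bs) ! k)"])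
  also have "\<dots> = (\<Sum>as\<in>{as. length as = r}. \<Sum>x\<in>UNIV. (\<Prod>k<r. f k (as ! k)) * f r x)"
    by (intro sum.cong refl) (simp add: nth_append)
  also have "\<dots> = (\<Prod>k<Suc r. \<Sum>x\<in>UNIV. f k x)"
    by (simp add: Suc sum_product)
  finally show ?case by simp
qed

lemma prod_append_split:
  assumes "length as = r1" "length as' = r1"
  shows "(\<Prod>k<r1+r2. A $ ((as @ bs) ! k) $ ((as' @ bs') ! k))
    = (\<Prod>k<r1. A $ (as ! k) $ (as' ! k)) * (\<Prod>k<r2. A $ (bs ! k) $ (bs' ! k))"
proof -
  have un: "{..<r1+r2} = {..<r1} \<union> {r1..<r1+r2}" by auto
  have "(\<Prod>k<r1+r2. A $ ((as @ bs) ! k) $ ((as' @ bs') ! k))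
    = (\<Prod>k<r1. A $ ((as @ bs) ! k) $ ((as' @ bs') ! k))
      * (\<Prod>k\<in>{r1..<r1+r2}. A $ ((as @ bs) ! k) $ ((as' @ bs') ! k))"
    unfolding un by (rule prod.union_disjoint) auto
  also have "(\<Prod>k\<in>{r1..<r1+r2}. A $ ((as @ bs) ! k) $ ((as' @ bs') ! k))
    = (\<Prod>k<r2. A $ (bs ! k) $ (bs' ! k))"
    by (rule prod.reindex_bij_witness[of _ "\<lambda>k. k + r1" "\<lambda>k. k - r1"]) (use assms in \<open>auto simp: nth_append\<close>)
  also have "(\<Prod>k<r1. A $ ((as @ bs) ! k) $ ((as' @ bs') ! k)) = (\<Prod>k<r1. A $ (as ! k) $ (as' ! k))"
    by (intro prod.cong) (use assms in \<open>auto simp: nth_append\<close>)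
  finally show ?thesis .
qed

lemma tensor_pow_act_length: "length is \<noteq> r \<Longrightarrow> tensor_pow_act r g T is = 0"
  by (simp add: tensor_pow_act_def)

lemma tensor_pow_act_cong:
  assumes "\<And>js. length js = r \<Longrightarrow> S js = T js"
  shows "tensor_pow_act r g S is = tensor_pow_act r g T is"
  using assms by (simp add: tensor_pow_act_def)

text \<open>The coefficient product over all slots factors into one product per block. Equivariance
  of a valuation concerns all slots at once; this form connects it with separate actions on the two
  factors.\<close>

lemma tensor_pow_act_append:
  assumes "length as = r1" "length bs = r2"
  shows "tensor_pow_act (r1 + r2) g T (as @ bs)
    = tensor_pow_act r1 g (\<lambda>as'. tensor_pow_act r2 g (\<lambda>bs'. T (as' @ bs')) bs) as"
  using assms
  by (simp add: tensor_pow_act_def sum_lists_append prod_append_split sum_distrib_left mult.assoc)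

lemma id_tensor_act_append:
  assumes "length as = r1"
  shows "id_tensor_act r1 r2 g T (as @ bs) = tensor_pow_act r2 g (\<lambda>bs'. T (as @ bs')) bs"
  using assms by (simp add: tensor_pow_act_def id_tensor_act_def)

lemma tensor_pow_act_mult:
  "tensor_pow_act r (A ** B) T is = tensor_pow_act r A (tensor_pow_act r B T) is"
proof (cases "length is = r")
  case True
  have "tensor_pow_act r (A ** B) T is = (\<Sum>js\<in>{js. length js = r}.
      (\<Sum>ks\<in>{ks. length ks = r}. \<Prod>k<r. A $ (is ! k) $ (ks ! k) * B $ (ks ! k) $ (js ! k)) * T js)"
    using True by (simp add: tensor_pow_act_def matrix_matrix_mult_def prod_sum_lists)
  also have "\<dots> = (\<Sum>js\<in>{js. length js = r}. \<Sum>ks\<in>{ks. length ks = r}.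
      (\<Prod>k<r. A $ (is ! k) $ (ks ! k)) * ((\<Prod>k<r. B $ (ks ! k) $ (js ! k)) * T js))"
    by (simp add: prod.distrib sum_distrib_right mult.assoc)
  also have "\<dots> = (\<Sum>ks\<in>{ks. length ks = r}. (\<Prod>k<r. A $ (is ! k) $ (ks ! k))
      * (\<Sum>js\<in>{js. length js = r}. (\<Prod>k<r. B $ (ks ! k) $ (js ! k)) * T js))"
    by (subst sum.swap) (simp add: sum_distrib_left)
  also have "\<dots> = tensor_pow_act r A (tensor_pow_act r B T) is"
    using True by (simp add: tensor_pow_act_def)
  finally show ?thesis .
qed (simp add: tensor_pow_act_def)

text \<open>The two actions involve disjoint groups of indices, so only two finite sums are
  exchanged.\<close>

lemma tensor_pow_act_swap:
  "tensor_pow_act r1 A (\<lambda>as. tensor_pow_act r2 B (T as) bs) is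
    = tensor_pow_act r2 B (\<lambda>bs. tensor_pow_act r1 A (\<lambda>as. T as bs) is) bs"
proof (cases "length is = r1 \<and> length bs = r2")
  case True
  then show ?thesis
    unfolding tensor_pow_act_def by (simp add: sum_distrib_left)
      (subst sum.swap, simp add: mult.left_commute)
qed (auto simp: tensor_pow_act_def)

lemma tensor_pow_act_add:
  "tensor_pow_act r g (\<lambda>js. S js + T js) is = tensor_pow_act r g S is + tensor_pow_act r g T is"
  by (simp add: tensor_pow_act_def sum.distrib algebra_simps)

lemma tensor_pow_act_diff:
  "tensor_pow_act r g (\<lambda>js. S js - T js) is = tensor_pow_act r g S is - tensor_pow_act r g T is"
  by (simp add: tensor_pow_act_def sum_subtractf algebra_simps)

lemma tensor_pow_act_scale:
  "tensor_pow_act r g (\<lambda>js. c * T js) is = c * tensor_pow_act r g T is"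
  by (simp add: tensor_pow_act_def sum_distrib_left algebra_simps)

lemma tendsto_tensor_pow_act:
  assumes "(g \<longlongrightarrow> A) F" "\<And>js. ((\<lambda>k. T k js) \<longlongrightarrow> S js) F"
  shows "((\<lambda>k. tensor_pow_act r (g k) (T k) is) \<longlongrightarrow> tensor_pow_act r A S is) F"
proof (cases "length is = r")
  case True
  then show ?thesis
    unfolding tensor_pow_act_def using assms by (auto intro!: tendsto_intros)
qed (simp add: tensor_pow_act_def)

section \<open>Symmetric tensors: permuting and freezing slots\<close>

lemma Sym_iff:
  "T \<in> Sym r \<longleftrightarrow> (\<forall>is. length is \<noteq> r \<longrightarrow> T is = 0) \<and>
    (\<forall>is p. length is = r \<longrightarrow> p permutes {..<r} \<longrightarrow> T (permute_list p is) = T is)"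
  by (auto simp: Sym_def is_tensor_def permute_list_def)

lemma Sym_permute:
  "T \<in> Sym r \<Longrightarrow> length is = r \<Longrightarrow> p permutes {..<r} \<Longrightarrow> T (permute_list p is) = T is"
  by (simp add: Sym_iff)

lemma Sym_length: "T \<in> Sym r \<Longrightarrow> length is \<noteq> r \<Longrightarrow> T is = 0"
  by (simp add: Sym_iff)

lemma permutes_lessThan_less: "p permutes {..<r} \<Longrightarrow> k < r \<Longrightarrow> p k < (r::nat)"
  using permutes_in_image[of p "{..<r}" k] by simp

lemma permute_list_append_left:
  assumes "p permutes {..<r1}" "length as = r1" "length bs = r2"
  shows "permute_list p (as @ bs) = permute_list p as @ bs"
proof (rule nth_equalityI)
  fix k assume "k < length (permute_list p (as @ bs))"
  then have "k < r1 + r2" using assms by simp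
  then show "permute_list p (as @ bs) ! k = (permute_list p as @ bs) ! k"
    using assms permutes_lessThan_less[OF assms(1), of k] permutes_not_in[OF assms(1), of k]
    by (auto simp: nth_append permute_list_def)
qed (use assms in auto)

text \<open>\<open>q\<close> carries p to the last r2 slots by a shift by r1 and fixes the first r1
  slots. For the left block p itself already fixes the remaining slots, so no such transport occurs
  there.\<close>

lemma permute_list_append_right:
  assumes "p permutes {..<r2}" "length as = r1" "length bs = r2"
  defines "q \<equiv> \<lambda>k. if k < r1 then k else r1 + p (k - r1)"
  shows "q permutes {..<r1 + r2}" "permute_list q (as @ bs) = as @ permute_list p bs"
proof -
  define q' where "q' = (\<lambda>k. if k < r1 then k else r1 + inv p (k - r1))"
  have "bij_betw q {..<r1 + r2} {..<r1 + r2}"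
  proof (rule bij_betwI[where g = q'])
    have ip: "inv p permutes {..<r2}" using assms(1) by (rule permutes_inv)
    show "q \<in> {..<r1 + r2} \<rightarrow> {..<r1 + r2}"
      using permutes_lessThan_less[OF assms(1)] by (auto simp: q_def)
    show "q' \<in> {..<r1 + r2} \<rightarrow> {..<r1 + r2}"
      using permutes_lessThan_less[OF ip] by (auto simp: q'_def)
  qed (auto simp: q_def q'_def permutes_inverses[OF assms(1)])
  moreover have "q k = k" if "k \<notin> {..<r1 + r2}" for k
    using that permutes_not_in[OF assms(1), of "k - r1"] by (auto simp: q_def)
  ultimately show "q permutes {..<r1 + r2}" by (rule bij_imp_permutes)
  show "permute_list q (as @ bs) = as @ permute_list p bs"
  proof (rule nth_equalityI)
    fix k assume "k < length (permute_list q (as @ bs))"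
    then have "k < r1 + r2" using assms by simp
    then show "permute_list q (as @ bs) ! k = (as @ permute_list p bs) ! k"
      using assms(2,3) by (auto simp: nth_append q_def permute_list_def)
  qed (use assms in auto)
qed

text \<open>Together with \<open>Sym_append_right\<close> this is the inclusion of Sym^(r1+r2) in
  the product of Sym^r1 and Sym^r2: freezing some slots keeps the symmetry in the others.\<close>

lemma Sym_append_left:
  assumes "T \<in> Sym (r1 + r2)" "length bs = r2"
  shows "(\<lambda>as. T (as @ bs)) \<in> Sym r1"
proof -
  have "T (permute_list p as @ bs) = T (as @ bs)"
    if as: "length as = r1" and p: "p permutes {..<r1}" for as p
  proof -
    have "p permutes {..<r1 + r2}" by (rule permutes_subset[OF p]) auto
    from Sym_permute[OF assms(1) _ this, of "as @ bs"] show ?thesis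
      using as assms(2) by (simp add: permute_list_append_left[OF p as assms(2)])
  qed
  moreover have "T (as @ bs) = 0" if "length as \<noteq> r1" for as
    using that assms by (intro Sym_length[OF assms(1)]) simp
  ultimately show ?thesis by (simp add: Sym_iff)
qed

lemma Sym_append_right:
  assumes "T \<in> Sym (r1 + r2)" "length as = r1"
  shows "(\<lambda>bs. T (as @ bs)) \<in> Sym r2"
proof -
  have "T (as @ permute_list p bs) = T (as @ bs)"
    if bs: "length bs = r2" and p: "p permutes {..<r2}" for bs p
    using Sym_permute[OF assms(1) _ permute_list_append_right(1)[OF p assms(2) bs], of "as @ bs"]
      bs assms(2) by (simp add: permute_list_append_right(2)[OF p assms(2) bs])
  moreover have "T (as @ bs) = 0" if "length bs \<noteq> r2" for bs
    using that assms by (intro Sym_length[OF assms(1)]) simp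
  ultimately show ?thesis by (simp add: Sym_iff)
qed

lemma permute_list_inv:
  assumes "p permutes {..<r}" "length xs = r"
  shows "permute_list (inv p) (permute_list p xs) = xs"
    "permute_list p (permute_list (inv p) xs) = xs"
  using assms permutes_inv[OF assms(1)]
  by (auto intro!: nth_equalityI
      simp: permute_list_nth permutes_lessThan_less permutes_inverses[OF assms(1)])

text \<open>Permuting the summation index by p does not change T, by symmetry. The matrix factors
  then carry \<open>p k\<close> in both indices, and a product over all slots is unchanged by
  reindexing.\<close>

lemma tensor_pow_act_Sym:
  assumes T: "T \<in> Sym r"
  shows "tensor_pow_act r g T \<in> Sym r"
proof -
  have "tensor_pow_act r g T (permute_list p is) = tensor_pow_act r g T is"
    if len: "length is = r" and p: "p permutes {..<r}" for "is" p
  proof -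
    have bij: "bij_betw (permute_list p) {js :: 'a list. length js = r} {js. length js = r}"
      by (rule bij_betwI[where g = "permute_list (inv p)"])
        (auto simp: permute_list_inv[OF p])
    have "tensor_pow_act r g T (permute_list p is) = (\<Sum>js\<in>{js. length js = r}.
        (\<Prod>k<r. g $ (permute_list p is ! k) $ (js ! k)) * T js)"
      using len by (simp add: tensor_pow_act_def)
    also have "\<dots> = (\<Sum>js\<in>{js. length js = r}.
        (\<Prod>k<r. g $ (permute_list p is ! k) $ (permute_list p js ! k)) * T (permute_list p js))"
      by (rule sum.reindex_bij_betw[OF bij, symmetric])
    also have "\<dots> = (\<Sum>js\<in>{js. length js = r}. (\<Prod>k<r. g $ (is ! p k) $ (js ! p k)) * T js)"
      by (intro sum.cong refl arg_cong2[where f = "(*)"] prod.cong) (auto simp: Sym_permute[OF T _ p] permute_list_nth that)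
    also have "\<dots> = (\<Sum>js\<in>{js. length js = r}. (\<Prod>k<r. g $ (is ! k) $ (js ! k)) * T js)"
      using prod.permute[OF p, of "\<lambda>k. g $ (is ! k) $ (_ ! k)"] by (simp add: o_def)
    finally show ?thesis using len by (simp add: tensor_pow_act_def)
  qed
  then show ?thesis by (simp add: Sym_iff tensor_pow_act_length)
qed

subsection \<open>Matrix inverses and the orthogonal group\<close>

lemma matrix_inv_eqI:
  assumes "A ** B = mat 1" "B ** A = mat 1"
  shows "matrix_inv A = B"
  unfolding matrix_inv_def
proof (rule some_equality)
  fix A' assume "A ** A' = mat 1 \<and> A' ** A = mat 1"
  then show "A' = B"
    by (metis assms(1) matrix_mul_assoc matrix_mul_lid matrix_mul_rid)
qed (use assms in auto)

lemma matrix_inv_orthogonal: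
  fixes A :: "real^'n::finite^'n"
  assumes "orthogonal_matrix A"
  shows "matrix_inv A = transpose A"
  using assms by (intro matrix_inv_eqI) (auto simp: orthogonal_matrix_def)

lemma continuous_on_det [continuous_intros]:
  fixes f :: "'a::topological_space \<Rightarrow> real^'n::finite^'n"
  assumes "continuous_on S f"
  shows "continuous_on S (\<lambda>x. det (f x))"
  unfolding det_def using assms by (intro continuous_intros)

text \<open>A singular matrix has no inverse, so \<open>matrix_inv\<close> takes there the arbitrary but constant
  value \<open>SOME B. False\<close>.\<close>
lemma borel_measurable_matrix_inv:
  "(matrix_inv :: real^'n::finite^'n \<Rightarrow> _) \<in> borel_measurable borel"
proof -
  \<comment> \<open>Cramer's rule for the l-th column of the inverse: column k of A is replaced by
    the l-th unit vector. It exhibits inversion as continuous where the determinant is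
    nonzero.\<close>
  define cof :: "real^'n^'n \<Rightarrow> real^'n^'n" where
    "cof A = (\<chi> k l. det (\<chi> i j. if j = k then (if i = l then 1 else 0) else A $ i $ j) / det A)" for A
  have inv: "matrix_inv A = (if det A \<noteq> 0 then cof A else (SOME B. False))" for A
  proof (cases "det A = 0")
    case False
    then obtain B where B: "A ** B = mat 1" "B ** A = mat 1"
      using invertible_det_nz[of A] unfolding invertible_def by blast
    have "B $ k $ l = cof A $ k $ l" for k l
    proof -
      have "A *v (B *v axis l 1) = axis l 1"
        by (simp add: matrix_vector_mul_assoc B)
      then have "B *v axis l 1
          = (\<chi> k. det (\<chi> i j. if j = k then axis l 1 $ i else A $ i $ j) / det A)"
        using cramer[OF False] by blast
      then have "(B *v axis l 1) $ k = cof A $ k $ l"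
        by (simp add: cof_def axis_def cong: if_cong)
      then show ?thesis
        by (simp add: matrix_vector_mul_component inner_axis)
    qed
    then have "cof A = B" by (simp add: vec_eq_iff)
    with False B show ?thesis by (simp add: matrix_inv_eqI)
  next
    case True
    then have "(\<lambda>B. A ** B = mat 1 \<and> B ** A = mat 1) = (\<lambda>B. False)"
      using invertible_det_nz[of A] unfolding invertible_def by blast
    then have "matrix_inv A = (SOME B. False)"
      unfolding matrix_inv_def by (rule arg_cong)
    with True show ?thesis by simp
  qed
  have entry: "continuous_on UNIV
      (\<lambda>A :: real^'n^'n. if j = k then (if i = l then 1 else 0) else A $ i $ j)" for i j k l :: 'n
    by (cases "j = k") (auto intro!: continuous_intros)
  have "open {A :: real^'n^'n. det A \<noteq> 0}"
    by (intro open_Collect_neq continuous_intros)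
  moreover have "continuous_on {A. det A \<noteq> 0} cof"
    unfolding cof_def by (intro continuous_intros continuous_on_subset[OF entry]) auto
  ultimately have "(\<lambda>A. if A \<in> {A. det A \<noteq> 0} then cof A else (SOME B. False)) \<in> borel_measurable borel"
    by (intro borel_measurable_continuous_on_if) (auto intro: borel_open)
  then show ?thesis by (simp add: inv[abs_def])
qed

text \<open>Rows are unit vectors, and the norm is at most the sum of the row norms. This supplies
  boundedness, hence compactness, of the group.\<close>

lemma norm_orthogonal_matrix_le:
  fixes A :: "real^'n::finite^'n"
  assumes "orthogonal_matrix A"
  shows "norm A \<le> CARD('n)"
proof -
  have "norm (A $ i) = 1" for i
    using assms by (simp add: orthogonal_matrix_orthonormal_rows row_def)
  moreover have "norm A \<le> (\<Sum>i\<in>UNIV. norm (A $ i))"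
    unfolding norm_vec_def by (rule L2_set_le_sum) simp
  ultimately show ?thesis by simp
qed

lemma continuous_on_matrix_mult [continuous_intros]:
  fixes f :: "'a::topological_space \<Rightarrow> real^'n::finite^'m::finite" and g :: "'a \<Rightarrow> real^'k::finite^'n"
  assumes "continuous_on S f" "continuous_on S g"
  shows "continuous_on S (\<lambda>x. f x ** g x)"
  unfolding matrix_matrix_mult_def using assms by (intro continuous_intros)

lemma continuous_on_transpose [continuous_intros]:
  fixes f :: "'a::topological_space \<Rightarrow> real^'n::finite^'m::finite"
  assumes "continuous_on S f"
  shows "continuous_on S (\<lambda>x. transpose (f x))"
  unfolding transpose_def using assms by (intro continuous_intros)

subsection \<open>Haar measure on a closed subgroup of SO(n)\<close>

locale haar_subgroup_SO =
  fixes G :: "(real^'n::finite^'n) set" and \<mu> :: "(real^'n^'n) measure"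
  assumes subgroup: "closed_connected_subgroup_SO G"
    and haar: "haar_prob G \<mu>"
begin

lemma orthogonal: "g \<in> G \<Longrightarrow> orthogonal_matrix g"
  using subgroup by (auto simp: closed_connected_subgroup_SO_def SO_mat_def)

lemma mult_mem: "g \<in> G \<Longrightarrow> h \<in> G \<Longrightarrow> g ** h \<in> G"
  using subgroup by (auto simp: closed_connected_subgroup_SO_def)

lemma transpose_mem: "g \<in> G \<Longrightarrow> transpose g \<in> G"
  using subgroup matrix_inv_orthogonal[OF orthogonal]
  by (metis closed_connected_subgroup_SO_def)

lemma mult_transpose [simp]:
  assumes "g \<in> G"
  shows "transpose g ** g = mat 1" "g ** transpose g = mat 1"
  using orthogonal[OF assms] by (auto simp: orthogonal_matrix_def)

lemma compact: "compact G"
proof -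
  have "bounded G"
    using norm_orthogonal_matrix_le orthogonal unfolding bounded_iff by blast
  then show ?thesis
    using subgroup by (simp add: compact_eq_bounded_closed closed_connected_subgroup_SO_def)
qed

lemma prob_space: "prob_space \<mu>" and sets_eq [measurable_cong]: "sets \<mu> = sets borel"
  using haar by (auto simp: haar_prob_def)

lemma space_eq [simp]: "space \<mu> = UNIV"
  using sets_eq_imp_space_eq[OF sets_eq] by simp

lemma G_sets [measurable]: "G \<in> sets borel"
  using subgroup by (simp add: closed_connected_subgroup_SO_def borel_closed)

lemma AE_mem: "AE g in \<mu>. g \<in> G"
proof -
  interpret prob_space \<mu> by (rule prob_space)
  have "prob G = 1" using haar by (simp add: haar_prob_def measure_def)
  then show ?thesis by (rule AE_prob_1)
qed

lemma measurable_mult_left [measurable]: "(\<lambda>g. h ** g) \<in> borel_measurable (borel :: (real^'n^'n) measure)"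
  by (intro borel_measurable_continuous_onI continuous_intros)

lemma measurable_mult_right [measurable]: "(\<lambda>g. g ** h) \<in> borel_measurable (borel :: (real^'n^'n) measure)"
  by (intro borel_measurable_continuous_onI continuous_intros)

lemma measurable_transpose [measurable]: "transpose \<in> borel_measurable (borel :: (real^'n^'n) measure)"
  by (intro borel_measurable_continuous_onI continuous_intros)

text \<open>\<open>haar_prob\<close> states invariance for images of Borel subsets of G. Cutting
  with G, which has full measure, turns it into a statement on preimages of arbitrary Borel sets,
  the form suited to \<open>distr\<close>.\<close>

lemma emeasure_left_mult:
  assumes h: "h \<in> G" and A: "A \<in> sets borel"
  shows "emeasure \<mu> {g. h ** g \<in> A} = emeasure \<mu> A"
proof -
  have S: "{g. h ** g \<in> A} \<in> sets borel"
    using measurable_sets[OF measurable_mult_left A, of h] by (simp add: vimage_def)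
  define B where "B = {g. h ** g \<in> A} \<inter> G"
  have B: "B \<in> sets borel" "B \<subseteq> G" using S by (auto simp: B_def)
  have "(\<lambda>g. h ** g) ` B = A \<inter> G"
  proof
    show "(\<lambda>g. h ** g) ` B \<subseteq> A \<inter> G" using h mult_mem by (auto simp: B_def)
    show "A \<inter> G \<subseteq> (\<lambda>g. h ** g) ` B"
    proof
      fix x assume x: "x \<in> A \<inter> G"
      have "h ** (transpose h ** x) = x" using h by (simp add: matrix_mul_assoc)
      moreover have "transpose h ** x \<in> G" using h x by (simp add: mult_mem transpose_mem)
      ultimately show "x \<in> (\<lambda>g. h ** g) ` B" using x unfolding B_def by force
    qed
  qed
  then have "emeasure \<mu> (A \<inter> G) = emeasure \<mu> B"
    using haar h B unfolding haar_prob_def by metis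
  moreover have "emeasure \<mu> (A \<inter> G) = emeasure \<mu> A" "emeasure \<mu> B = emeasure \<mu> {g. h ** g \<in> A}"
    using AE_mem S A B by (auto intro!: emeasure_eq_AE simp: B_def sets_eq)
  ultimately show ?thesis by simp
qed

text \<open>Left invariance implies right invariance: computing the convolution of \<open>\<mu>\<close> with its
  image under inversion in both orders shows that \<open>\<mu>\<close> is invariant under inversion.\<close>
lemma emeasure_transpose:
  assumes A: "A \<in> sets borel"
  shows "emeasure \<mu> {g. transpose g \<in> A} = emeasure \<mu> A"
proof -
  define \<nu> where "\<nu> = distr \<mu> borel transpose"
  have sets_\<nu> [measurable_cong]: "sets \<nu> = sets borel" by (simp add: \<nu>_def)
  have space_\<nu>: "space \<nu> = UNIV" by (simp add: \<nu>_def)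
  interpret \<mu>: prob_space \<mu> by (rule prob_space)
  interpret \<nu>: prob_space \<nu>
    unfolding \<nu>_def by (rule \<mu>.prob_space_distr) simp
  interpret P: pair_sigma_finite \<nu> \<mu> ..
  have \<nu>: "emeasure \<nu> B = emeasure \<mu> {g. transpose g \<in> B}" if "B \<in> sets borel" for B
    using that by (simp add: \<nu>_def emeasure_distr vimage_def)
  have AE_\<nu>: "AE g in \<nu>. g \<in> G"
    unfolding \<nu>_def using AE_mem by (subst AE_distr_iff) (auto elim!: eventually_mono intro: transpose_mem)
  \<comment> \<open>The product measure of S is the convolution evaluated at A. Integrating over h
    first, left invariance of \<mu> removes g; integrating over g first, right invariance of \<nu>
    removes h.\<close>
  define S where "S = {gh :: (real^'n^'n) \<times> (real^'n^'n). fst gh ** snd gh \<in> A}"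
  have "(\<lambda>gh :: (real^'n^'n) \<times> (real^'n^'n). fst gh ** snd gh) \<in> borel_measurable borel"
    by (intro borel_measurable_continuous_onI continuous_intros)
  moreover have "sets (\<nu> \<Otimes>\<^sub>M \<mu>) = sets borel"
    using sets_pair_measure_cong[OF sets_\<nu> sets_eq] unfolding borel_prod .
  ultimately have S: "S \<in> sets (\<nu> \<Otimes>\<^sub>M \<mu>)"
    using measurable_sets[of _ borel borel A] A by (auto simp: S_def vimage_def)
  have "emeasure (\<nu> \<Otimes>\<^sub>M \<mu>) S = (\<integral>\<^sup>+g. emeasure \<mu> {h. g ** h \<in> A} \<partial>\<nu>)"
    using S by (subst \<mu>.emeasure_pair_measure_alt) (auto simp: S_def vimage_def)
  also have "\<dots> = (\<integral>\<^sup>+g. emeasure \<mu> A \<partial>\<nu>)"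
    by (intro nn_integral_cong_AE) (use AE_\<nu> A in \<open>auto elim!: eventually_mono simp: emeasure_left_mult\<close>)
  also have "\<dots> = emeasure \<mu> A"
    by (simp add: \<nu>.emeasure_space_1)
  finally have 1: "emeasure (\<nu> \<Otimes>\<^sub>M \<mu>) S = emeasure \<mu> A" .
  \<comment> \<open>Transposition reverses products, so right translation by h under \<nu> becomes
    left translation by \<open>transpose h\<close> under \<mu>.\<close>
  have "emeasure \<nu> {g. g ** h \<in> A} = emeasure \<nu> A" if h: "h \<in> G" for h
  proof -
    have "{g. g ** h \<in> A} \<in> sets borel"
      using measurable_sets[OF measurable_mult_right A, of h] by (simp add: vimage_def)
    then have "emeasure \<nu> {g. g ** h \<in> A} = emeasure \<mu> {g. transpose g ** h \<in> A}"
      by (simp add: \<nu>)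
    also have "{g. transpose g ** h \<in> A} = {g. transpose h ** g \<in> {g. transpose g \<in> A}}"
      by (simp add: matrix_transpose_mul)
    also have "emeasure \<mu> \<dots> = emeasure \<mu> {g. transpose g \<in> A}"
      using measurable_sets[OF measurable_transpose A]
      by (intro emeasure_left_mult transpose_mem h) (simp add: vimage_def)
    finally show ?thesis using A by (simp add: \<nu>)
  qed
  note right = this
  have "emeasure (\<nu> \<Otimes>\<^sub>M \<mu>) S = (\<integral>\<^sup>+h. emeasure \<nu> {g. g ** h \<in> A} \<partial>\<mu>)"
    using S by (subst P.emeasure_pair_measure_alt2) (auto simp: S_def vimage_def)
  also have "\<dots> = (\<integral>\<^sup>+h. emeasure \<nu> A \<partial>\<mu>)"
    by (intro nn_integral_cong_AE) (use AE_mem right in \<open>auto elim!: eventually_mono\<close>)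
  also have "\<dots> = emeasure \<nu> A"
    using \<mu>.emeasure_space_1 by simp
  finally show ?thesis using 1 A by (simp add: \<nu>)
qed

text \<open>Right translation by h is left translation by \<open>transpose h\<close> conjugated with
  transposition, and \<mu> is invariant under both.\<close>

lemma emeasure_right_mult:
  assumes h: "h \<in> G" and A: "A \<in> sets borel"
  shows "emeasure \<mu> {g. g ** h \<in> A} = emeasure \<mu> A"
proof -
  have T: "{g. transpose g \<in> A} \<in> sets borel"
    using measurable_sets[OF measurable_transpose A] by (simp add: vimage_def)
  have "{g. g ** h \<in> A} \<in> sets borel"
    using measurable_sets[OF measurable_mult_right A, of h] by (simp add: vimage_def)
  then have "emeasure \<mu> {g. g ** h \<in> A} = emeasure \<mu> {g. transpose g \<in> {g. g ** h \<in> A}}"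
    by (simp only: emeasure_transpose)
  also have "{g. transpose g \<in> {g. g ** h \<in> A}} = {g. transpose h ** g \<in> {g. transpose g \<in> A}}"
    by (simp add: matrix_transpose_mul)
  also have "emeasure \<mu> \<dots> = emeasure \<mu> A"
    using emeasure_left_mult[OF transpose_mem[OF h] T] emeasure_transpose[OF A] by simp
  finally show ?thesis .
qed

lemma distr_left_mult: "h \<in> G \<Longrightarrow> distr \<mu> borel (\<lambda>g. h ** g) = \<mu>"
  by (rule measure_eqI) (auto simp: sets_eq emeasure_distr emeasure_left_mult vimage_def)

lemma distr_right_mult: "h \<in> G \<Longrightarrow> distr \<mu> borel (\<lambda>g. g ** h) = \<mu>"
  by (rule measure_eqI) (auto simp: sets_eq emeasure_distr emeasure_right_mult vimage_def)

lemma integral_left_mult: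
  fixes f :: "real^'n^'n \<Rightarrow> real"
  assumes "h \<in> G" "f \<in> borel_measurable borel"
  shows "(LINT g|\<mu>. f (h ** g)) = (LINT g|\<mu>. f g)"
  using integral_distr[of "\<lambda>g. h ** g" \<mu> borel f] assms by (simp add: distr_left_mult)

lemma integral_right_mult:
  fixes f :: "real^'n^'n \<Rightarrow> real"
  assumes "h \<in> G" "f \<in> borel_measurable borel"
  shows "(LINT g|\<mu>. f (g ** h)) = (LINT g|\<mu>. f g)"
  using integral_distr[of "\<lambda>g. g ** h" \<mu> borel f] assms by (simp add: distr_right_mult)

text \<open>A continuous function may be unbounded on the space of matrices, but \<mu> lives on the
  compact set G, where it is bounded.\<close>

lemma integrable_continuous:
  fixes f :: "real^'n^'n \<Rightarrow> real"
  assumes "continuous_on UNIV f"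
  shows "integrable \<mu> f"
proof -
  interpret prob_space \<mu> by (rule prob_space)
  have "Elementary_Metric_Spaces.bounded (f ` G)"
    using compact_continuous_image[OF continuous_on_subset[OF assms] compact]
    by (auto intro: compact_imp_bounded)
  then obtain B where "\<And>g. g \<in> G \<Longrightarrow> norm (f g) \<le> B"
    by (auto simp: bounded_iff)
  then show ?thesis
    using AE_mem borel_measurable_continuous_onI[OF assms]
    by (intro integrable_const_bound[where B = B]) (auto elim!: eventually_mono simp: measurable_cong_sets[OF sets_eq])
qed

text \<open>Continuous convergence of continuous functions on the compact group is uniform.\<close>
lemma tendsto_integral:
  fixes f :: "nat \<Rightarrow> real^'n^'n \<Rightarrow> real"
  assumes cont: "\<And>k. continuous_on UNIV (f k)" "continuous_on UNIV f0"
    and lim: "\<And>s gs g. strict_mono s \<Longrightarrow> gs \<longlonglongrightarrow> g \<Longrightarrow> (\<lambda>k. f (s k) (gs k)) \<longlonglongrightarrow> f0 g"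
  shows "(\<lambda>k. LINT g|\<mu>. f k g) \<longlonglongrightarrow> (LINT g|\<mu>. f0 g)"
proof (rule LIMSEQ_I)
  interpret prob_space \<mu> by (rule prob_space)
  fix e :: real assume e: "0 < e"
  \<comment> \<open>Half of e, because integrating the pointwise bound yields only a weak
    inequality.\<close>
  have "\<exists>N. \<forall>k\<ge>N. \<forall>g\<in>G. norm (f k g - f0 g) < e / 2"
  proof (rule ccontr)
    assume "\<not> ?thesis"
    then have "\<exists>\<^sub>\<infinity>k. \<exists>g\<in>G. \<not> norm (f k g - f0 g) < e / 2"
      unfolding INFM_nat_le by blast
    then have inf: "infinite {k. \<exists>g\<in>G. \<not> norm (f k g - f0 g) < e / 2}"
      by (simp add: frequently_cofinite)
    \<comment> \<open>\<open>s\<close> enumerates indices at which uniform closeness fails. By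
      compactness the offending points converge along a further subsequence \<open>t\<close>, which
      contradicts \<open>lim\<close> and the continuity of \<open>f0\<close>.\<close>
    obtain s :: "nat \<Rightarrow> nat" where s: "strict_mono s" "\<And>k. \<exists>g\<in>G. \<not> norm (f (s k) g - f0 g) < e / 2"
      using infinite_enumerate[OF inf] by auto
    then obtain gs where gs: "\<And>k. gs k \<in> G" "\<And>k. \<not> norm (f (s k) (gs k) - f0 (gs k)) < e / 2"
      by metis
    obtain g t where t: "g \<in> G" "strict_mono (t :: nat \<Rightarrow> nat)" "(gs \<circ> t) \<longlonglongrightarrow> g"
      using compact gs(1) unfolding compact_def by metis
    have "(\<lambda>k. f (s (t k)) (gs (t k))) \<longlonglongrightarrow> f0 g"
      using lim[OF strict_mono_o[OF s(1) t(2)] t(3)] by (simp add: o_def)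
    moreover have "(\<lambda>k. f0 (gs (t k))) \<longlonglongrightarrow> f0 g"
      using cont(2) t(3) by (auto simp: continuous_on_sequentially o_def)
    ultimately have "(\<lambda>k. f (s (t k)) (gs (t k)) - f0 (gs (t k))) \<longlonglongrightarrow> 0"
      using tendsto_diff by fastforce
    from LIMSEQ_D[OF this, of "e / 2"] e gs(2) show False by auto
  qed
  then obtain N where N: "\<And>k g. k \<ge> N \<Longrightarrow> g \<in> G \<Longrightarrow> norm (f k g - f0 g) < e / 2" by blast
  have "norm ((LINT g|\<mu>. f k g) - (LINT g|\<mu>. f0 g)) < e" if k: "k \<ge> N" for k
  proof -
    have diff: "(LINT g|\<mu>. f k g) - (LINT g|\<mu>. f0 g) = (LINT g|\<mu>. f k g - f0 g)"
      using cont by (simp add: integrable_continuous)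
    have "norm (LINT g|\<mu>. f k g - f0 g) \<le> (LINT g|\<mu>. norm (f k g - f0 g))"
      by (rule integral_norm_bound)
    moreover have "(LINT g|\<mu>. norm (f k g - f0 g)) \<le> (LINT g|\<mu>. e / 2)"
      using cont N[OF k] AE_mem
      by (intro integral_mono_AE integrable_norm)
        (auto simp: integrable_continuous elim!: eventually_mono intro!: less_imp_le)
    moreover have "(LINT g|\<mu>. e / 2) = e / 2"
      using prob_space by simp
    ultimately show ?thesis unfolding diff using e by linarith
  qed
  then show "\<exists>N. \<forall>k\<ge>N. norm ((LINT g|\<mu>. f k g) - (LINT g|\<mu>. f0 g)) < e" by blast
qed

end

subsection \<open>Tensor valuations\<close>

lemma Val_Sym: "\<Phi> \<in> Val r \<Longrightarrow> convex_body K \<Longrightarrow> \<Phi> K \<in> Sym r"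
  by (simp add: Val_def)

lemma Val_translation: "\<Phi> \<in> Val r \<Longrightarrow> convex_body K \<Longrightarrow> \<Phi> ((+) x ` K) = \<Phi> K"
  by (simp add: Val_def)

lemma Val_tendsto: "\<Phi> \<in> Val r \<Longrightarrow> hausdorff_lim Ks K \<Longrightarrow> (\<lambda>k. \<Phi> (Ks k) is) \<longlonglongrightarrow> \<Phi> K is"
  by (simp add: Val_def hausdorff_lim_def)

lemma Val_Un:
  assumes "\<Phi> \<in> Val r" "convex_body K" "convex_body L" "convex (K \<union> L)"
  shows "\<Phi> (K \<union> L) is = \<Phi> K is + \<Phi> L is - \<Phi> (K \<inter> L) is"
proof -
  have "\<Phi> (K \<union> L) = (\<lambda>is. \<Phi> K is + \<Phi> L is - \<Phi> (K \<inter> L) is)"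
    using assms unfolding Val_def by blast
  then show ?thesis by simp
qed

lemma ValI:
  assumes "\<And>K. convex_body K \<Longrightarrow> \<Phi> K \<in> Sym r"
    and "\<And>K x is. convex_body K \<Longrightarrow> \<Phi> ((+) x ` K) is = \<Phi> K is"
    and "\<And>Ks K is. hausdorff_lim Ks K \<Longrightarrow> (\<lambda>k. \<Phi> (Ks k) is) \<longlonglongrightarrow> \<Phi> K is"
    and "\<And>K L is. convex_body K \<Longrightarrow> convex_body L \<Longrightarrow> convex (K \<union> L)
      \<Longrightarrow> \<Phi> (K \<union> L) is = \<Phi> K is + \<Phi> L is - \<Phi> (K \<inter> L) is"
  shows "\<Phi> \<in> Val r"
  using assms unfolding Val_def by (auto simp: fun_eq_iff hausdorff_lim_def)

lemma ValG_Val: "\<Phi> \<in> ValG r G \<Longrightarrow> \<Phi> \<in> Val r"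
  by (simp add: ValG_def)

lemma ValG_act:
  "\<Phi> \<in> ValG r G \<Longrightarrow> g \<in> G \<Longrightarrow> convex_body K
    \<Longrightarrow> tensor_pow_act r g (\<Phi> ((*v) (matrix_inv g) ` K)) = \<Phi> K"
  by (simp add: ValG_def)

lemma ValG_I:
  assumes "\<Phi> \<in> Val r"
    and "\<And>g K is. g \<in> G \<Longrightarrow> convex_body K
      \<Longrightarrow> tensor_pow_act r g (\<Phi> ((*v) (matrix_inv g) ` K)) is = \<Phi> K is"
  shows "\<Phi> \<in> ValG r G"
  using assms unfolding ValG_def by (auto simp: fun_eq_iff)

lemma is_basis_ValG_coefficients:
  assumes "is_basis_ValG r G m B" "\<Phi> \<in> ValG r G"
  shows "\<exists>c. \<forall>K is. convex_body K \<longrightarrow> \<Phi> K is = (\<Sum>i<m. c i * B i K is)"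
  using assms by (simp add: is_basis_ValG_def)

text \<open>The content is that translates, unions, intersections and matrix images occurring in the
  clauses of \<open>ValG\<close> are bodies again. It serves functions that are set to zero off
  convex bodies.\<close>

lemma ValG_cong:
  fixes \<Phi> \<Psi> :: "(real^'n::finite) set \<Rightarrow> 'n tensor"
  assumes \<Phi>: "\<Phi> \<in> ValG r G" and eq: "\<And>K. convex_body K \<Longrightarrow> \<Psi> K = \<Phi> K"
  shows "\<Psi> \<in> ValG r G"
proof (rule ValG_I)
  note V = ValG_Val[OF \<Phi>]
  show "\<Psi> \<in> Val r"
  proof (rule ValI)
    fix K L :: "(real^'n) set" and "is" assume KL: "convex_body K" "convex_body L" "convex (K \<union> L)"
    then have "convex_body (K \<union> L)" by (auto simp: convex_body_def compact_Un)
    then show "\<Psi> (K \<union> L) is = \<Psi> K is + \<Psi> L is - \<Psi> (K \<inter> L) is"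
      using Val_Un[OF V KL] eq KL convex_body_Int by metis
  next
    fix Ks and K :: "(real^'n) set" and "is" assume "hausdorff_lim Ks K"
    then show "(\<lambda>k. \<Psi> (Ks k) is) \<longlonglongrightarrow> \<Psi> K is"
      using Val_tendsto[OF V, of Ks K "is"] eq by (simp add: hausdorff_lim_def)
  qed (use V eq in \<open>auto simp: Val_Sym Val_translation convex_body_translation\<close>)
qed (use \<Phi> eq in \<open>auto simp: ValG_act convex_body_matrix_image\<close>)

lemma ValG_combination:
  fixes \<Phi> \<Psi> :: "(real^'n::finite) set \<Rightarrow> 'n tensor"
  assumes "\<Phi> \<in> ValG r G" "\<Psi> \<in> ValG r G"
  shows "(\<lambda>K is. a * \<Phi> K is + b * \<Psi> K is) \<in> ValG r G"
proof (rule ValG_I)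
  note V = ValG_Val[OF assms(1)] ValG_Val[OF assms(2)]
  show "(\<lambda>K is. a * \<Phi> K is + b * \<Psi> K is) \<in> Val r"
  proof (rule ValI)
    fix K :: "(real^'n) set" assume "convex_body K"
    then show "(\<lambda>is. a * \<Phi> K is + b * \<Psi> K is) \<in> Sym r"
      using Val_Sym[OF V(1)] Val_Sym[OF V(2)] by (simp add: Sym_iff)
  qed (use V in \<open>auto simp: Val_translation Val_Un algebra_simps
      intro!: tendsto_intros Val_tendsto[OF V(1)] Val_tendsto[OF V(2)]\<close>)
  show "tensor_pow_act r g (\<lambda>is. a * \<Phi> ((*v) (matrix_inv g) ` K) is + b * \<Psi> ((*v) (matrix_inv g) ` K) is) is
      = a * \<Phi> K is + b * \<Psi> K is" if "g \<in> G" "convex_body K" for g and K :: "(real^'n) set" and "is"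
    using ValG_act[OF assms(1) that] ValG_act[OF assms(2) that]
    by (simp add: tensor_pow_act_add tensor_pow_act_scale)
qed

subsection \<open>Coefficients with respect to independent functions\<close>

text \<open>Induction on the number of functions: subtracting from each \<open>H x\<close> the multiple of \<open>H x0\<close> that
  kills \<open>\<psi> m\<close>, for some \<open>x0\<close> with \<open>\<psi> m x0 \<noteq> 0\<close>, is a Gaussian elimination step.\<close>
lemma coefficients_mem_subspace:
  fixes \<psi> :: "nat \<Rightarrow> 'x \<Rightarrow> real" and c :: "nat \<Rightarrow> 'y \<Rightarrow> real"
  assumes comb: "\<And>u v a b. u \<in> W \<Longrightarrow> v \<in> W \<Longrightarrow> (\<lambda>y. a * u y + b * v y) \<in> W"
    and "\<And>x. x \<in> X \<Longrightarrow> H x \<in> W"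
    and "\<And>x y. x \<in> X \<Longrightarrow> H x y = (\<Sum>j<m. c j y * \<psi> j x)"
    and "\<And>d. (\<And>x. x \<in> X \<Longrightarrow> (\<Sum>j<m. d j * \<psi> j x) = 0) \<Longrightarrow> \<forall>j<m. d j = (0::real)"
  shows "\<forall>j<m. c j \<in> W"
  using assms(2-)
proof (induction m arbitrary: H \<psi>)
  case 0
  then show ?case by simp
next
  case (Suc m)
  note indep = Suc.prems(3)
  obtain x0 where x0: "x0 \<in> X" "\<psi> m x0 \<noteq> 0"
  proof (rule ccontr)
    assume "\<not> thesis"
    \<comment> \<open>If \<open>\<psi> m\<close> vanished on X, the coefficient vector with a single
      1 at m would be a nontrivial relation.\<close>
    then have "(\<Sum>j<Suc m. (if j = m then 1 else 0) * \<psi> j x) = 0" if "x \<in> X" for x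
      using that \<open>\<And>x0. \<lbrakk>x0 \<in> X; \<psi> m x0 \<noteq> 0\<rbrakk> \<Longrightarrow> thesis\<close> by auto
    from indep[OF this] show False by auto
  qed
  \<comment> \<open>\<open>\<psi>' m\<close> vanishes identically, so the expansion of
    \<open>H'\<close> involves only the first m coefficients.\<close>
  define \<psi>' where "\<psi>' j x = \<psi> j x - \<psi> m x / \<psi> m x0 * \<psi> j x0" for j x
  define H' where "H' x y = 1 * H x y + (- (\<psi> m x / \<psi> m x0)) * H x0 y" for x y
  have cm: "\<forall>j<m. c j \<in> W"
  proof (rule Suc.IH[of H' \<psi>'])
    show "H' x \<in> W" if "x \<in> X" for x
      unfolding H'_def by (intro comb Suc.prems(1) that x0)
    show "H' x y = (\<Sum>j<m. c j y * \<psi>' j x)" if "x \<in> X" for x y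
    proof -
      have "H' x y = (\<Sum>j<Suc m. c j y * \<psi>' j x)"
        using Suc.prems(2)[OF that] Suc.prems(2)[OF x0(1)]
        by (simp add: H'_def \<psi>'_def algebra_simps sum_subtractf sum_negf sum_distrib_left del: sum.lessThan_Suc)
      then show ?thesis using x0(2) by (simp add: \<psi>'_def)
    qed
    fix d assume d: "\<And>x. x \<in> X \<Longrightarrow> (\<Sum>j<m. d j * \<psi>' j x) = 0"
    \<comment> \<open>The last entry is the coefficient of \<open>\<psi> m\<close> that appears on
      expanding each \<open>\<psi>' j\<close>, so a relation among the reduced functions becomes one
      among the original ones.\<close>
    define d' where "d' j = (if j < m then d j else - (\<Sum>j<m. d j * \<psi> j x0) / \<psi> m x0)" for j
    have "(\<Sum>j<Suc m. d' j * \<psi> j x) = 0" if "x \<in> X" for x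
    proof -
      have "(\<Sum>j<Suc m. d' j * \<psi> j x) = (\<Sum>j<m. d j * \<psi>' j x)"
        by (simp add: d'_def \<psi>'_def algebra_simps sum_subtractf sum_distrib_left sum_divide_distrib)
      then show ?thesis using d[OF that] by simp
    qed
    from indep[OF this] show "\<forall>j<m. d j = 0" unfolding d'_def by (metis less_Suc_eq)
  qed
  \<comment> \<open>Closure of W is given for binary combinations, so the sum is built up from a
    multiple of \<open>H x0\<close>, already known to lie in W.\<close>
  have sum_mem: "(\<lambda>y. a * H x0 y + (\<Sum>j<k. b j * c j y)) \<in> W" if "k \<le> m" for k a b
    using that
  proof (induction k)
    case 0
    show ?case using comb[OF Suc.prems(1)[OF x0(1)] Suc.prems(1)[OF x0(1)], of a 0] by simp
  next
    case (Suc k)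
    then show ?case
      using comb[of "\<lambda>y. a * H x0 y + (\<Sum>j<k. b j * c j y)" "c k" 1 "b k"] cm
      by (simp add: add.assoc)
  qed
  have "c m y = 1 / \<psi> m x0 * H x0 y + (\<Sum>j<m. - (\<psi> j x0 / \<psi> m x0) * c j y)" for y
    using Suc.prems(2)[OF x0(1), of y] x0(2)
    by (simp add: field_simps sum_negf sum_distrib_left sum_divide_distrib)
  then have "c m = (\<lambda>y. 1 / \<psi> m x0 * H x0 y + (\<Sum>j<m. - (\<psi> j x0 / \<psi> m x0) * c j y))"
    by (rule ext)
  then have "c m \<in> W"
    using sum_mem[of m "1 / \<psi> m x0" "\<lambda>j. - (\<psi> j x0 / \<psi> m x0)"] by simp
  with cm show ?case by (auto simp: less_Suc_eq)
qed

subsection \<open>The additive kinematic integral in coordinates\<close>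

text \<open>g mixes only the trailing indices, so the result is a finite linear combination of
  slices of T that are symmetric in the leading ones.\<close>

lemma tensor_pow_act_Sym_left:
  assumes "T \<in> Sym (r1 + r2)"
  shows "(\<lambda>as. tensor_pow_act r2 g (\<lambda>bs'. T (as @ bs')) bs) \<in> Sym r1"
proof -
  have S: "(\<lambda>as. T (as @ bs')) \<in> Sym r1" if "length bs' = r2" for bs'
    using Sym_append_left[OF assms that] .
  have "tensor_pow_act r2 g (\<lambda>bs'. T (permute_list p as @ bs')) bs = tensor_pow_act r2 g (\<lambda>bs'. T (as @ bs')) bs"
    if "length as = r1" "p permutes {..<r1}" for as p
    using Sym_permute[OF S that] by (intro tensor_pow_act_cong)
  moreover have "tensor_pow_act r2 g (\<lambda>bs'. T (as @ bs')) bs = 0" if "length as \<noteq> r1" for as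
    using Sym_length[OF S that] by (simp add: tensor_pow_act_def)
  ultimately show ?thesis by (simp add: Sym_iff)
qed

lemma tensor_pow_act_Sym_right:
  assumes "T \<in> Sym (r1 + r2)" "length as = r1"
  shows "(\<lambda>bs. tensor_pow_act r2 g (\<lambda>bs'. T (as @ bs')) bs) \<in> Sym r2"
  using tensor_pow_act_Sym[OF Sym_append_right[OF assms]] .

text \<open>As a simp rule this would rewrite \<open>transpose g *v x\<close> to \<open>x v* g\<close>, out of reach of the facts
  about \<open>(*v) A\<close>.\<close>
declare transpose_matrix_vector [simp del]

text \<open>The matrix \<open>A\<close> moving \<open>L\<close> and the matrix \<open>g\<close> acting on tensors are kept apart so that the
  integrand is jointly continuous on all pairs of matrices; on the group \<open>A\<close> is the inverse of \<open>g\<close>.\<close>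
definition kin_integrand :: "nat \<Rightarrow> ((real^'n::finite) set \<Rightarrow> 'n tensor) \<Rightarrow> (real^'n) set \<Rightarrow>
    (real^'n) set \<Rightarrow> 'n list \<Rightarrow> 'n list \<Rightarrow> real^'n^'n \<Rightarrow> real^'n^'n \<Rightarrow> real" where
  "kin_integrand r2 \<Phi> K L as bs A g =
    tensor_pow_act r2 g (\<lambda>bs'. \<Phi> (minkowski_sum K ((*v) A ` L)) (as @ bs')) bs"

lemma tendsto_kin_integrand:
  assumes "\<Phi> \<in> Val r" "hausdorff_lim Ks K" "hausdorff_lim Ls L" "As \<longlonglongrightarrow> A" "gs \<longlonglongrightarrow> g"
  shows "(\<lambda>k. kin_integrand r2 \<Phi> (Ks k) (Ls k) as bs (As k) (gs k))
    \<longlonglongrightarrow> kin_integrand r2 \<Phi> K L as bs A g"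
  unfolding kin_integrand_def
  by (intro tendsto_tensor_pow_act Val_tendsto[OF assms(1)] hausdorff_lim_minkowski_sum
      hausdorff_lim_matrix_image assms)

lemma continuous_on_kin_integrand:
  fixes f h :: "'a::metric_space \<Rightarrow> real^'n::finite^'n"
  assumes \<Phi>: "\<Phi> \<in> Val r" "convex_body K" "convex_body L"
    and "continuous_on S f" "continuous_on S h"
  shows "continuous_on S (\<lambda>x. kin_integrand r2 \<Phi> K L as bs (f x) (h x))"
  unfolding continuous_on_sequentially
proof safe
  fix x a assume "\<forall>n. x n \<in> S" "a \<in> S" "x \<longlonglongrightarrow> a"
  then have "(\<lambda>k. f (x k)) \<longlonglongrightarrow> f a" "(\<lambda>k. h (x k)) \<longlonglongrightarrow> h a"
    using assms(4,5) by (auto simp: continuous_on_sequentially o_def)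
  then show "((\<lambda>x. kin_integrand r2 \<Phi> K L as bs (f x) (h x)) \<circ> x)
      \<longlonglongrightarrow> kin_integrand r2 \<Phi> K L as bs (f a) (h a)"
    using \<Phi> by (auto simp: o_def intro!: tendsto_kin_integrand hausdorff_lim_const)
qed

section \<open>The integral as an equivariant valuation in each body\<close>

context haar_subgroup_SO
begin

definition kin :: "nat \<Rightarrow> ((real^'n) set \<Rightarrow> 'n tensor) \<Rightarrow> (real^'n) set \<Rightarrow> (real^'n) set \<Rightarrow>
    'n list \<Rightarrow> 'n list \<Rightarrow> real" where
  "kin r2 \<Phi> K L as bs = (LINT g|\<mu>. kin_integrand r2 \<Phi> K L as bs (transpose g) g)"

lemma continuous_kin_integrand:
  assumes "\<Phi> \<in> Val r" "convex_body K" "convex_body L"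
  shows "continuous_on UNIV (\<lambda>g. kin_integrand r2 \<Phi> K L as bs (transpose g) g)"
  using assms by (intro continuous_on_kin_integrand continuous_intros)

lemma integrable_kin_integrand:
  assumes "\<Phi> \<in> Val r" "convex_body K" "convex_body L"
  shows "integrable \<mu> (\<lambda>g. kin_integrand r2 \<Phi> K L as bs (transpose g) g)"
  using assms by (intro integrable_continuous continuous_kin_integrand)

text \<open>Inverse and transpose agree on G, hence almost everywhere, and the integrals agree once
  both integrands are measurable. With \<open>matrix_inv\<close> the integrand is a jointly
  continuous function of two matrices composed with a Borel map.\<close>

lemma additive_kinematic_append:
  assumes \<Phi>: "\<Phi> \<in> Val r" "convex_body K" "convex_body L" and as: "length as = r1"
  shows "additive_kinematic r1 r2 \<mu> \<Phi> K L (as @ bs) = kin r2 \<Phi> K L as bs"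
proof -
  have "continuous_on UNIV (\<lambda>x. kin_integrand r2 \<Phi> K L as bs (fst x) (snd x))"
    using \<Phi> by (intro continuous_on_kin_integrand continuous_intros)
  then have "(\<lambda>g. kin_integrand r2 \<Phi> K L as bs (fst (matrix_inv g, g)) (snd (matrix_inv g, g)))
      \<in> borel_measurable borel"
    by (rule borel_measurable_continuous_on) (intro borel_measurable_Pair borel_measurable_matrix_inv measurable_ident_sets refl)
  then have inv: "(\<lambda>g. kin_integrand r2 \<Phi> K L as bs (matrix_inv g) g) \<in> borel_measurable \<mu>"
    by (simp add: measurable_cong_sets[OF sets_eq])
  have tr: "(\<lambda>g. kin_integrand r2 \<Phi> K L as bs (transpose g) g) \<in> borel_measurable \<mu>"
    using integrable_kin_integrand[OF \<Phi>] by simp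
  have "additive_kinematic r1 r2 \<mu> \<Phi> K L (as @ bs)
      = (LINT g|\<mu>. kin_integrand r2 \<Phi> K L as bs (matrix_inv g) g)"
    by (simp add: additive_kinematic_def id_tensor_act_append as kin_integrand_def)
  also have "\<dots> = kin r2 \<Phi> K L as bs"
    unfolding kin_def using inv tr AE_mem
    by (intro integral_cong_AE) (auto elim!: eventually_mono simp: matrix_inv_orthogonal orthogonal)
  finally show ?thesis .
qed

lemma tendsto_kin:
  assumes \<Phi>: "\<Phi> \<in> Val r" and K: "hausdorff_lim Ks K" and L: "hausdorff_lim Ls L"
  shows "(\<lambda>k. kin r2 \<Phi> (Ks k) (Ls k) as bs) \<longlonglongrightarrow> kin r2 \<Phi> K L as bs"
  unfolding kin_def
proof (rule tendsto_integral)
  fix s :: "nat \<Rightarrow> nat" and gs and g :: "real^'n^'n" assume s: "strict_mono s" and g: "gs \<longlonglongrightarrow> g"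
  have tr: "(\<lambda>k. transpose (gs k)) \<longlonglongrightarrow> transpose g"
    unfolding transpose_def by (intro tendsto_intros g)
  show "(\<lambda>k. kin_integrand r2 \<Phi> (Ks (s k)) (Ls (s k)) as bs (transpose (gs k)) (gs k))
      \<longlonglongrightarrow> kin_integrand r2 \<Phi> K L as bs (transpose g) g"
    by (rule tendsto_kin_integrand[OF \<Phi> hausdorff_lim_subseq[OF K s] hausdorff_lim_subseq[OF L s] tr g])
qed (use \<Phi> K L in \<open>auto simp: hausdorff_lim_def intro!: continuous_kin_integrand\<close>)

lemma integral_Sym:
  assumes "\<And>g. f g \<in> Sym r"
  shows "(\<lambda>is. LINT g|\<mu>. f g is) \<in> Sym r"
  using assms by (simp add: Sym_iff)

lemma tensor_pow_act_integral:
  assumes "\<And>is. integrable \<mu> (\<lambda>g. f g is)"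
  shows "tensor_pow_act r h (\<lambda>is. LINT g|\<mu>. f g is) is = (LINT g|\<mu>. tensor_pow_act r h (f g) is)"
  using assms by (simp add: tensor_pow_act_def)

text \<open>For equivariance under h, substitute g h for g. Then h acts on the first block and g h
  on the second, while the body becomes h^-1 (K + g^-1 L). The action of h on both blocks is
  absorbed by equivariance of \<Phi>, which leaves the original integrand at g.\<close>

lemma kin_mem_ValG_left:
  assumes \<Phi>: "\<Phi> \<in> ValG (r1 + r2) G" and L: "convex_body L" and bs: "length bs = r2"
  shows "(\<lambda>K as. kin r2 \<Phi> K L as bs) \<in> ValG r1 G"
proof (rule ValG_I)
  note V = ValG_Val[OF \<Phi>]
  have body: "convex_body (minkowski_sum K ((*v) A ` L))" if "convex_body K" for K and A :: "real^'n^'n"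
    using that L by (intro convex_body_minkowski_sum convex_body_matrix_image)
  have Sym: "(\<lambda>as. kin r2 \<Phi> K L as bs) \<in> Sym r1" if "convex_body K" for K
    unfolding kin_def kin_integrand_def
    by (intro integral_Sym tensor_pow_act_Sym_left Val_Sym[OF V] body that)
  show "(\<lambda>K as. kin r2 \<Phi> K L as bs) \<in> Val r1"
  proof (rule ValI)
    fix K :: "(real^'n) set" and as x assume K: "convex_body K"
    show "kin r2 \<Phi> ((+) x ` K) L as bs = kin r2 \<Phi> K L as bs"
      using body[OF K]
      by (simp add: kin_def kin_integrand_def minkowski_sum_translation_left Val_translation[OF V])
  next
    fix K K' :: "(real^'n) set" and as assume K: "convex_body K" "convex_body K'" "convex (K \<union> K')"
    have "convex (minkowski_sum (K \<union> K') ((*v) A ` L))" for A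
      using K L convex_body_matrix_image by (intro convex_minkowski_sum) (auto simp: convex_body_def)
    then have "\<Phi> (minkowski_sum (K \<union> K') ((*v) A ` L)) is
        = \<Phi> (minkowski_sum K ((*v) A ` L)) is + \<Phi> (minkowski_sum K' ((*v) A ` L)) is
          - \<Phi> (minkowski_sum (K \<inter> K') ((*v) A ` L)) is" for A "is"
      using Val_Un[OF V body[OF K(1)] body[OF K(2)]] K L
      by (simp add: minkowski_sum_Un_left minkowski_sum_Int_left convex_body_matrix_image)
    then show "kin r2 \<Phi> (K \<union> K') L as bs
        = kin r2 \<Phi> K L as bs + kin r2 \<Phi> K' L as bs - kin r2 \<Phi> (K \<inter> K') L as bs"
      using integrable_kin_integrand[OF V _ L] K convex_body_Int[OF K]
      by (simp add: kin_def kin_integrand_def tensor_pow_act_add tensor_pow_act_diff)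
  qed (use Sym L V in \<open>auto intro!: tendsto_kin hausdorff_lim_const\<close>)
  fix h as and K :: "(real^'n) set" assume h: "h \<in> G" and K: "convex_body K"
  define K' where "K' = (*v) (transpose h) ` K"
  have K': "convex_body K'" unfolding K'_def by (rule convex_body_matrix_image[OF K])
  define u where "u g = tensor_pow_act r1 h (\<lambda>as. kin_integrand r2 \<Phi> K' L as bs (transpose g) g) as" for g
  show "tensor_pow_act r1 h (\<lambda>as. kin r2 \<Phi> ((*v) (matrix_inv h) ` K) L as bs) as = kin r2 \<Phi> K L as bs"
  proof (cases "length as = r1")
    case True
    have u_mult: "u (g ** h) = kin_integrand r2 \<Phi> K L as bs (transpose g) g" for g
    proof -
      define M where "M = minkowski_sum K ((*v) (transpose g) ` L)"
      define T where "T = \<Phi> ((*v) (transpose h) ` M)"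
      have "minkowski_sum K' ((*v) (transpose (g ** h)) ` L) = (*v) (transpose h) ` M"
        by (simp add: K'_def M_def matrix_image_minkowski_sum matrix_transpose_mul image_image
            matrix_vector_mul_assoc)
      then have "u (g ** h) = tensor_pow_act r1 h
          (\<lambda>as. tensor_pow_act r2 g (tensor_pow_act r2 h (\<lambda>bs'. T (as @ bs'))) bs) as"
        by (simp add: u_def kin_integrand_def T_def tensor_pow_act_mult)
      also have "\<dots> = tensor_pow_act r2 g
          (\<lambda>bs. tensor_pow_act r1 h (\<lambda>as. tensor_pow_act r2 h (\<lambda>bs'. T (as @ bs')) bs) as) bs"
        by (rule tensor_pow_act_swap)
      also have "\<dots> = tensor_pow_act r2 g (\<lambda>bs. tensor_pow_act (r1 + r2) h T (as @ bs)) bs"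
        by (intro tensor_pow_act_cong) (simp add: tensor_pow_act_append True)
      also have "tensor_pow_act (r1 + r2) h T = \<Phi> M"
        using ValG_act[OF \<Phi> h, of M] body[OF K] by (simp add: T_def M_def matrix_inv_orthogonal orthogonal h)
      finally show ?thesis by (simp add: kin_integrand_def M_def)
    qed
    have cont: "continuous_on UNIV u"
      unfolding u_def tensor_pow_act_def using True
      by (auto intro!: continuous_intros continuous_kin_integrand[OF V K' L])
    have "tensor_pow_act r1 h (\<lambda>as. kin r2 \<Phi> K' L as bs) as = (LINT g|\<mu>. u g)"
      unfolding kin_def u_def
      by (rule tensor_pow_act_integral) (intro integrable_kin_integrand[OF V K' L])
    also have "\<dots> = (LINT g|\<mu>. u (g ** h))"
      by (rule integral_right_mult[symmetric, OF h borel_measurable_continuous_onI[OF cont]])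
    finally show ?thesis
      by (simp add: u_mult kin_def K'_def matrix_inv_orthogonal orthogonal h)
  next
    case False
    then show ?thesis using Sym_length[OF Sym[OF K]] by (simp add: tensor_pow_act_length)
  qed
qed

text \<open>For equivariance under h, applying h after g on the second block gives h g, and g^-1
  h^-1 L is (h g)^-1 L. The integrand thus appears at h g, and left invariance removes h.\<close>

lemma kin_mem_ValG_right:
  assumes \<Phi>: "\<Phi> \<in> ValG (r1 + r2) G" and K: "convex_body K" and as: "length as = r1"
  shows "(\<lambda>L bs. kin r2 \<Phi> K L as bs) \<in> ValG r2 G"
proof (rule ValG_I)
  note V = ValG_Val[OF \<Phi>]
  have body: "convex_body (minkowski_sum K ((*v) A ` L))" if "convex_body L" for L and A :: "real^'n^'n"
    using that K by (intro convex_body_minkowski_sum convex_body_matrix_image)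
  have Sym: "(\<lambda>bs. kin r2 \<Phi> K L as bs) \<in> Sym r2" if "convex_body L" for L
    unfolding kin_def kin_integrand_def
    by (intro integral_Sym tensor_pow_act_Sym_right[OF _ as] Val_Sym[OF V] body that)
  show "(\<lambda>L bs. kin r2 \<Phi> K L as bs) \<in> Val r2"
  proof (rule ValI)
    fix L :: "(real^'n) set" and bs x assume L: "convex_body L"
    \<comment> \<open>The resulting translation vector depends on A, which is harmless because
      \<Phi> is invariant under every translation.\<close>
    have "minkowski_sum K ((*v) A ` (+) x ` L) = (+) (A *v x) ` minkowski_sum K ((*v) A ` L)" for A
    proof -
      have "(*v) A ` (+) x ` L = (+) (A *v x) ` (*v) A ` L"
        by (simp add: image_image matrix_vector_right_distrib)
      then show ?thesis
        by (metis minkowski_sum_commute minkowski_sum_translation_left)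
    qed
    then show "kin r2 \<Phi> K ((+) x ` L) as bs = kin r2 \<Phi> K L as bs"
      using body[OF L]
      by (simp add: kin_def kin_integrand_def Val_translation[OF V])
  next
    fix L L' :: "(real^'n) set" and bs assume L: "convex_body L" "convex_body L'" "convex (L \<union> L')"
    \<comment> \<open>A ranges over all matrices, singular ones included. That its image commutes
      with this intersection is due to convexity of the union, not to injectivity.\<close>
    have *: "minkowski_sum K ((*v) A ` (L \<union> L'))
        = minkowski_sum K ((*v) A ` L) \<union> minkowski_sum K ((*v) A ` L')"
      "minkowski_sum K ((*v) A ` (L \<inter> L'))
        = minkowski_sum K ((*v) A ` L) \<inter> minkowski_sum K ((*v) A ` L')"
      "convex (minkowski_sum K ((*v) A ` (L \<union> L')))" for A
    proof -
      have conv: "convex ((*v) A ` L \<union> (*v) A ` L')"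
        using convex_linear_image[OF matrix_vector_mul_linear L(3), of A] by (simp add: image_Un)
      have "(*v) A ` (L \<inter> L') = (*v) A ` L \<inter> (*v) A ` L'"
        using L by (intro linear_image_Int matrix_vector_mul_linear) (auto simp: convex_body_def compact_imp_closed)
      then show "minkowski_sum K ((*v) A ` (L \<inter> L'))
        = minkowski_sum K ((*v) A ` L) \<inter> minkowski_sum K ((*v) A ` L')"
        using minkowski_sum_Int_left[of "(*v) A ` L" "(*v) A ` L'" K] conv L K
        by (simp add: minkowski_sum_commute[of K] convex_body_matrix_image)
      show "minkowski_sum K ((*v) A ` (L \<union> L'))
        = minkowski_sum K ((*v) A ` L) \<union> minkowski_sum K ((*v) A ` L')"
        by (simp add: minkowski_sum_commute[of K] image_Un minkowski_sum_Un_left)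
      show "convex (minkowski_sum K ((*v) A ` (L \<union> L')))"
        using K conv by (intro convex_minkowski_sum) (auto simp: convex_body_def image_Un)
    qed
    have "\<Phi> (minkowski_sum K ((*v) A ` (L \<union> L'))) is
        = \<Phi> (minkowski_sum K ((*v) A ` L)) is + \<Phi> (minkowski_sum K ((*v) A ` L')) is
          - \<Phi> (minkowski_sum K ((*v) A ` (L \<inter> L'))) is" for A "is"
      using Val_Un[OF V body[OF L(1)] body[OF L(2)], of A A] *(3)[of A] by (simp only: *(1,2))
    then show "kin r2 \<Phi> K (L \<union> L') as bs
        = kin r2 \<Phi> K L as bs + kin r2 \<Phi> K L' as bs - kin r2 \<Phi> K (L \<inter> L') as bs"
      using integrable_kin_integrand[OF V K] L convex_body_Int[OF L]
      by (simp add: kin_def kin_integrand_def tensor_pow_act_add tensor_pow_act_diff)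
  qed (use Sym K V in \<open>auto intro!: tendsto_kin hausdorff_lim_const\<close>)
  fix h bs and L :: "(real^'n) set" assume h: "h \<in> G" and L: "convex_body L"
  define L' where "L' = (*v) (transpose h) ` L"
  have L': "convex_body L'" unfolding L'_def by (rule convex_body_matrix_image[OF L])
  have "tensor_pow_act r2 h (\<lambda>bs. kin r2 \<Phi> K L' as bs) bs
      = (LINT g|\<mu>. tensor_pow_act r2 h (\<lambda>bs. kin_integrand r2 \<Phi> K L' as bs (transpose g) g) bs)"
    unfolding kin_def by (rule tensor_pow_act_integral) (intro integrable_kin_integrand[OF V K L'])
  also have "\<dots> = (LINT g|\<mu>. kin_integrand r2 \<Phi> K L as bs (transpose (h ** g)) (h ** g))"
    by (simp add: kin_integrand_def L'_def matrix_transpose_mul image_image matrix_vector_mul_assoc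
        tensor_pow_act_mult)
  also have "\<dots> = kin r2 \<Phi> K L as bs"
    unfolding kin_def
    by (rule integral_left_mult[OF h borel_measurable_continuous_onI[OF continuous_kin_integrand[OF V K L]]])
  finally show "tensor_pow_act r2 h (\<lambda>bs. kin r2 \<Phi> K ((*v) (matrix_inv h) ` L) as bs) bs = kin r2 \<Phi> K L as bs"
    by (simp add: L'_def matrix_inv_orthogonal orthogonal h)
qed

end

section \<open>Expansion with respect to both bases\<close>

theorem theorem22:
  fixes G :: "(real^'n^'n::finite) set" and \<mu> :: "(real^'n^'n) measure"
    and r1 r2 m1 m2 :: nat
    and Phis Psis :: "nat \<Rightarrow> (real^'n) set \<Rightarrow> 'n tensor"
    and \<Phi> :: "(real^'n) set \<Rightarrow> 'n tensor"
  assumes "closed_connected_subgroup_SO G"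
    and "transitive_on_sphere G"
    and "haar_prob G \<mu>"
    and "is_basis_ValG r1 G m1 Phis"
    and "is_basis_ValG r2 G m2 Psis"
    and "\<Phi> \<in> ValG (r1 + r2) G"
  shows "\<exists>c :: nat \<Rightarrow> nat \<Rightarrow> real. \<forall>K L. convex_body K \<longrightarrow> convex_body L \<longrightarrow>
     additive_kinematic r1 r2 \<mu> \<Phi> K L =
       (\<lambda>is. \<Sum>i<m1. \<Sum>j<m2. c i j * tensor_prod r1 r2 (Phis i K) (Psis j L) is)"
proof -
  interpret haar_subgroup_SO G \<mu> using assms by unfold_locales
  note \<Phi> = assms(6)
  have "\<exists>c. \<forall>L bs. convex_body L \<longrightarrow> kin r2 \<Phi> K L as bs = (\<Sum>j<m2. c j * Psis j L bs)"
    if "convex_body K" "length as = r1" for K as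
    using is_basis_ValG_coefficients[OF assms(5) kin_mem_ValG_right[OF \<Phi> that]] .
  then obtain C where C: "\<And>K as L bs. convex_body K \<Longrightarrow> length as = r1 \<Longrightarrow> convex_body L
      \<Longrightarrow> kin r2 \<Phi> K L as bs = (\<Sum>j<m2. C K as j * Psis j L bs)"
    by metis
  \<comment> \<open>The expansion by \<open>C\<close> is available only for bodies K and index lists
    of length r1. Setting \<open>H\<close> and \<open>c\<close> to zero elsewhere makes it hold at
    every point, as \<open>coefficients_mem_subspace\<close> demands. It also keeps each
    \<open>H x\<close> in \<open>W\<close>: \<open>ValG_cong\<close> ignores non-bodies, and the
    tensors vanish at other lengths.\<close>
  define H where "H = (\<lambda>(L, bs) (K, as).
    if convex_body K \<and> length as = r1 then kin r2 \<Phi> K L as bs else 0)"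
  define c where "c = (\<lambda>j (K, as). if convex_body K \<and> length as = r1 then C K as j else 0)"
  define W where "W = {w. (\<lambda>K as. w (K, as)) \<in> ValG r1 G}"
  define X where "X = {(L :: (real^'n) set, bs :: 'n list). convex_body L \<and> length bs = r2}"
  have "\<forall>j<m2. c j \<in> W"
  proof (rule coefficients_mem_subspace[where H = H and X = X and \<psi> = "\<lambda>j (L, bs). Psis j L bs"])
    show "(\<lambda>y. a * u y + b * v y) \<in> W" if "u \<in> W" "v \<in> W" for u v a b
      using that ValG_combination[of "\<lambda>K as. u (K, as)" r1 G "\<lambda>K as. v (K, as)" a b]
      by (simp add: W_def)
  next
    fix x assume "x \<in> X"
    then obtain L bs where x: "x = (L, bs)" "convex_body L" "length bs = r2" by (auto simp: X_def)
    note V = kin_mem_ValG_left[OF \<Phi> x(2,3)]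
    have "(\<lambda>K as. H x (K, as)) \<in> ValG r1 G"
      by (rule ValG_cong[OF V])
        (use Sym_length[OF Val_Sym[OF ValG_Val[OF V]]] in \<open>auto simp: H_def x fun_eq_iff\<close>)
    then show "H x \<in> W" by (simp add: W_def)
  next
    fix x and y :: "(real^'n) set \<times> 'n list" assume "x \<in> X"
    then obtain L bs where x: "x = (L, bs)" "convex_body L" by (auto simp: X_def)
    obtain K as where y: "y = (K, as)" by (cases y)
    show "H x y = (\<Sum>j<m2. c j y * (case x of (L, bs) \<Rightarrow> Psis j L bs))"
    proof (cases "convex_body K \<and> length as = r1")
      case True
      then show ?thesis using C[of K as L bs] x(2) by (simp add: x y H_def c_def)
    next
      case False
      then show ?thesis by (auto simp: x y H_def c_def)
    qed
  next
    fix d :: "nat \<Rightarrow> real"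
    assume d: "\<And>x. x \<in> X \<Longrightarrow> (\<Sum>j<m2. d j * (case x of (L, bs) \<Rightarrow> Psis j L bs)) = 0"
    \<comment> \<open>Independence in \<open>is_basis_ValG\<close> tests index lists of every
      length, while \<open>X\<close> contains only those of length r2; at other lengths each
      \<open>Psis j L\<close> vanishes.\<close>
    have "(\<Sum>j<m2. d j * Psis j L bs) = 0" if L: "convex_body L" for L bs
    proof (cases "length bs = r2")
      case True
      then show ?thesis using d[of "(L, bs)"] L by (simp add: X_def)
    next
      case False
      have "Psis j L bs = 0" if "j < m2" for j
        using Sym_length[OF Val_Sym[OF ValG_Val L] False] assms(5) that
        unfolding is_basis_ValG_def by blast
      then show ?thesis by simp
    qed
    then show "\<forall>j<m2. d j = 0"
      using assms(5) unfolding is_basis_ValG_def by blast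
  qed
  then have "\<exists>d. \<forall>K as. convex_body K \<longrightarrow> c j (K, as) = (\<Sum>i<m1. d i * Phis i K as)" if "j < m2" for j
    using that is_basis_ValG_coefficients[OF assms(4), of "\<lambda>K as. c j (K, as)"] by (simp add: W_def)
  then obtain D where D: "\<And>j K as. j < m2 \<Longrightarrow> convex_body K
      \<Longrightarrow> c j (K, as) = (\<Sum>i<m1. D j i * Phis i K as)"
    by metis
  have "additive_kinematic r1 r2 \<mu> \<Phi> K L is
      = (\<Sum>i<m1. \<Sum>j<m2. D j i * tensor_prod r1 r2 (Phis i K) (Psis j L) is)"
    if K: "convex_body K" and L: "convex_body L" for K L "is"
  proof (cases "length is = r1 + r2")
    case True
    then obtain as bs where ab: "is = as @ bs" "length as = r1" "length bs = r2"
      unfolding length_eq_add_iff by blast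
    have "additive_kinematic r1 r2 \<mu> \<Phi> K L is = (\<Sum>j<m2. c j (K, as) * Psis j L bs)"
      using additive_kinematic_append[OF ValG_Val[OF \<Phi>] K L ab(2)] C[OF K ab(2) L] ab K
      by (simp add: c_def)
    also have "\<dots> = (\<Sum>j<m2. \<Sum>i<m1. D j i * tensor_prod r1 r2 (Phis i K) (Psis j L) is)"
      using D K by (intro sum.cong refl) (simp add: tensor_prod_def ab sum_distrib_right mult.assoc)
    finally show ?thesis by (subst sum.swap)
  next
    case False
    then show ?thesis by (simp add: additive_kinematic_def id_tensor_act_def tensor_prod_def)
  qed
  then show ?thesis by (intro exI[of _ "\<lambda>i j. D j i"]) (simp add: fun_eq_iff)
qed

end
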